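(* Let $X$ be a separable real Banach space. The following statements are equivalent: (i) $X^{*}$ is separable. (ii) For every open convex set $U \subseteq X$, every continuous convex function $f : U \to \mathbb{R}$ and every $\varepsilon > 0$, there exists a convex function $g : U \to \mathbb{R}$ of class $C^1(U)$ such that $f(x) - \varepsilon \leq g(x) \leq f(x)$ for all $x \in U$.
   Context: $X^*$ is the topological dual of $X$ with its dual norm topology. A function is of class $C^1(U)$ if it is Fréchet differentiable at every point of $U$ with continuous derivative. The function $f$ is not assumed to be bounded on bounded sets. *)

theory Defs
  imports "HOL-Analysis.Analysis"
begin

text \<open>
  Class \<open>C\<^sup>1(U)\<close>, intended for open \<open>U\<close>. The derivative \<open>D\<close> takes values in the Banach space of
  bounded linear maps, and its continuity is with respect to the operator norm. On an open set
  \<open>D\<close> is uniquely determined by \<open>g\<close>, and values of \<open>g\<close> outside \<open>U\<close> play no role.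
\<close>

definition C1_on :: "'a::real_normed_vector set \<Rightarrow> ('a \<Rightarrow> 'b::real_normed_vector) \<Rightarrow> bool" where
  "C1_on U g \<longleftrightarrow>
     (\<exists>D :: 'a \<Rightarrow> 'a \<Rightarrow>\<^sub>L 'b.
        (\<forall>x\<in>U. (g has_derivative blinfun_apply (D x)) (at x)) \<and> continuous_on U D)"

end

theory Submission
  imports Defs
begin

text \<open>
  Suppose that the dual is separable, and consider first an \<open>L\<close>-Lipschitz convex
  function \<open>f\<close> on the whole space. By Hahn-Banach (\<open>ex_subgradient_of_lipschitz_convex\<close>), \<open>f\<close> is
  the supremum of its affine minorants \<open>\<phi> - c\<close> with \<open>norm \<phi> \<le> L\<close>. Charging every minorant a
  penalty \<open>e * \<theta> \<phi>\<close> with \<open>0 \<le> \<theta> \<le> 1\<close> lowers the supremum by at most \<open>e\<close>, and a well chosen \<open>\<theta>\<close>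
  makes the new supremum \<open>g\<close> smooth. Take \<open>\<theta> = (\<Sum>n. 2 ^ -(n+1) * (u n)\<^sup>2)\<close>, where the \<open>u n\<close> run
  through the distances to the points of a dense sequence of the dual and the evaluations at the
  points of a dense sequence of the space, all rescaled to take values in \<open>[0, 1]\<close> on the ball of
  radius \<open>L\<close>. Two minorants that are both nearly optimal at a point \<open>x\<close> have a midpoint that is not
  better than optimal, so the strict convexity of the square forces every \<open>u n\<close> to be nearly
  equal on them. The evaluations then make maximising sequences converge pointwise, and since
  \<open>\<theta>\<close> is weak-star lower semicontinuous the limit \<open>\<Phi> x\<close> is itself optimal. Some point of the
  dense sequence in the dual is close to \<open>\<Phi> x\<close>; every nearly optimal functional has almost the same
  distance to that point and is therefore close to \<open>\<Phi> x\<close> in norm. Hence \<open>\<Phi>\<close> is norm continuous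
  and is the Frechet derivative of \<open>g\<close>.

  A continuous convex \<open>f\<close> on an open convex \<open>U\<close> need not be Lipschitz, not even on bounded
  subsets of \<open>U\<close> away from the boundary. Its \<open>n\<close>-Lipschitz envelopes, however, agree with \<open>f\<close> near a
  given point as soon as \<open>n\<close> is large. Smooth convex approximations
  \<open>g n\<close> of the envelopes, shifted downwards by amounts that grow with \<open>n\<close>, are combined by a
  smooth maximum that ignores its second argument when it is smaller by a definite margin. Near a
  given point the shifts make all late \<open>g n\<close> smaller by such a margin, so the successive smooth
  maxima are locally stationary there and their limit is convex and of class \<open>C\<^sup>1\<close>
  (\<open>ex_C1_convex_approximation_if_lipschitz\<close>).

  Conversely, let \<open>g\<close> be a \<open>C\<^sup>1\<close> function with \<open>norm x - 1 \<le> g x\<close>. For \<open>norm \<phi> < 1\<close> the function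
  \<open>g - \<phi>\<close> is bounded below, so by Ekeland's variational principle its derivative takes arbitrarily
  small values. The derivatives of \<open>g\<close> are therefore dense in the unit ball of the dual, and they
  form a continuous image of a separable space.
\<close>

section \<open>Subgradients of Lipschitz convex functions\<close>

lemma lipschitz_on_real_le:
  fixes f :: "'a::real_normed_vector \<Rightarrow> real"
  assumes "L-lipschitz_on UNIV f"
  shows "f x \<le> f y + L * norm (x - y)"
  using lipschitz_onD[OF assms, of x y] by (auto simp: dist_norm)

lemma lipschitz_on_realI:
  fixes f :: "'a::real_normed_vector \<Rightarrow> real"
  assumes "0 \<le> L" "\<And>x y. f x \<le> f y + L * norm (x - y)"
  shows "L-lipschitz_on UNIV f"
proof (rule lipschitz_onI)
  fix x y
  show "dist (f x) (f y) \<le> L * dist x y"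
    using assms(2)[of x y] assms(2)[of y x] by (auto simp: dist_norm norm_minus_commute)
qed (rule assms)

lemma lipschitz_on_INF:
  fixes G :: "'a::real_normed_vector \<Rightarrow> 'b \<Rightarrow> real"
  assumes lip: "\<And>s. s \<in> S \<Longrightarrow> L-lipschitz_on UNIV (\<lambda>x. G x s)"
    and ne: "S \<noteq> {}" and bdd: "\<And>x. bdd_below (G x ` S)"
  shows "L-lipschitz_on UNIV (\<lambda>x. INF s\<in>S. G x s)"
proof (rule lipschitz_on_realI)
  show "0 \<le> L" using lip ne lipschitz_on_nonneg by blast
  fix x y
  have "(INF s\<in>S. G x s) - L * norm (x - y) \<le> (INF s\<in>S. G y s)"
  proof (rule cINF_greatest[OF ne])
    fix s assume s: "s \<in> S"
    have "(INF s\<in>S. G x s) \<le> G x s" by (rule cINF_lower[OF bdd s])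
    also have "\<dots> \<le> G y s + L * norm (x - y)" by (rule lipschitz_on_real_le[OF lip[OF s]])
    finally show "(INF s\<in>S. G x s) - L * norm (x - y) \<le> G y s" by simp
  qed
  then show "(INF s\<in>S. G x s) \<le> (INF s\<in>S. G y s) + L * norm (x - y)" by simp
qed

text \<open>
  Minimising a jointly convex function over one of its arguments leaves a convex function of the
  other one. Both the competitor in the Hahn-Banach argument and the Lipschitz envelopes of a
  convex function are infima of this kind.
\<close>

lemma convex_on_INF_marginal:
  fixes G :: "'a::real_vector \<Rightarrow> 'b::real_vector \<Rightarrow> real"
  assumes conv: "convex_on (UNIV \<times> S) (\<lambda>(x, s). G x s)"
    and ne: "S \<noteq> {}" and bdd: "\<And>x. bdd_below (G x ` S)"
  shows "convex_on UNIV (\<lambda>x. INF s\<in>S. G x s)"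
proof (rule convex_onI)
  fix t :: real and x y :: 'a assume t: "0 < t" "t < 1"
  let ?I = "\<lambda>x. INF s\<in>S. G x s"
  have cS: "convex S"
    using convex_linear_image[OF linear_snd convex_on_imp_convex[OF conv]] by simp
  show "?I ((1 - t) *\<^sub>R x + t *\<^sub>R y) \<le> (1 - t) * ?I x + t * ?I y"
  proof (rule field_le_epsilon)
    fix e :: real assume e: "0 < e"
    obtain a where a: "a \<in> S" "G x a < ?I x + e"
      using cINF_less_iff[OF ne bdd[of x], of "?I x + e"] e by auto
    obtain b where b: "b \<in> S" "G y b < ?I y + e"
      using cINF_less_iff[OF ne bdd[of y], of "?I y + e"] e by auto
    have ab: "(1 - t) *\<^sub>R a + t *\<^sub>R b \<in> S"
      using cS a b t by (simp add: convexD)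
    have "?I ((1 - t) *\<^sub>R x + t *\<^sub>R y) \<le> G ((1 - t) *\<^sub>R x + t *\<^sub>R y) ((1 - t) *\<^sub>R a + t *\<^sub>R b)"
      by (rule cINF_lower[OF bdd ab])
    also have "\<dots> \<le> (1 - t) * G x a + t * G y b"
      using convex_onD[OF conv, of t "(x, a)" "(y, b)"] a b t by simp
    also have "\<dots> \<le> (1 - t) * (?I x + e) + t * (?I y + e)"
      using a b t by (intro add_mono mult_left_mono) auto
    finally show "?I ((1 - t) *\<^sub>R x + t *\<^sub>R y) \<le> (1 - t) * ?I x + t * ?I y + e"
      by (simp add: algebra_simps)
  qed
qed simp

text \<open>
  An infimum of convex functions is in general not convex. In a chain, however, two members that are
  nearly optimal at two different points can be replaced by the smaller of the two.
\<close>

lemma convex_on_INF_chain: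
  fixes C :: "('a::real_vector \<Rightarrow> real) set"
  assumes conv: "\<And>h. h \<in> C \<Longrightarrow> convex_on UNIV h"
    and chain: "\<And>h k. h \<in> C \<Longrightarrow> k \<in> C \<Longrightarrow> h \<le> k \<or> k \<le> h"
    and ne: "C \<noteq> {}" and bdd: "\<And>x. bdd_below ((\<lambda>h. h x) ` C)"
  shows "convex_on UNIV (\<lambda>x. INF h\<in>C. h x)"
proof (rule convex_onI)
  fix t :: real and x y :: 'a assume t: "0 < t" "t < 1"
  let ?I = "\<lambda>x. INF h\<in>C. h x"
  show "?I ((1 - t) *\<^sub>R x + t *\<^sub>R y) \<le> (1 - t) * ?I x + t * ?I y"
  proof (rule field_le_epsilon)
    fix e :: real assume e: "0 < e"
    obtain a where a: "a \<in> C" "a x < ?I x + e"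
      using cINF_less_iff[OF ne bdd[of x], of "?I x + e"] e by auto
    obtain b where b: "b \<in> C" "b y < ?I y + e"
      using cINF_less_iff[OF ne bdd[of y], of "?I y + e"] e by auto
    obtain c where c: "c \<in> C" "c x \<le> a x" "c y \<le> b y"
      using chain[OF a(1) b(1)] a(1) b(1) by (auto simp: le_fun_def)
    have "?I ((1 - t) *\<^sub>R x + t *\<^sub>R y) \<le> c ((1 - t) *\<^sub>R x + t *\<^sub>R y)"
      by (rule cINF_lower[OF bdd c(1)])
    also have "\<dots> \<le> (1 - t) * c x + t * c y"
      using convex_onD[OF conv[OF c(1)], of t x y] t by simp
    also have "\<dots> \<le> (1 - t) * (?I x + e) + t * (?I y + e)"
      using a b c t by (intro add_mono mult_left_mono) auto
    finally show "?I ((1 - t) *\<^sub>R x + t *\<^sub>R y) \<le> (1 - t) * ?I x + t * ?I y + e"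
      by (simp add: algebra_simps)
  qed
qed simp

text \<open>
  This is the one-dimensional case of the existence of subgradients: the difference quotients at \<open>0\<close>
  from the left lie below those from the right, and \<open>s\<close> is the infimum of the latter.
\<close>

lemma ex_slope_of_convex_vanishing_at_0:
  fixes p :: "real \<Rightarrow> real"
  assumes conv: "convex_on UNIV p" and p0: "p 0 = 0"
  obtains s where "\<And>t. t * s \<le> p t"
proof -
  have key: "- p (- r) / r \<le> p t / t" if "0 < t" "0 < r" for t r
  proof -
    have "p ((1 - r / (t + r)) *\<^sub>R (-r) + (r / (t + r)) *\<^sub>R t)
        \<le> (1 - r / (t + r)) * p (- r) + r / (t + r) * p t"
      using that by (intro convex_onD[OF conv]) auto
    moreover have "(1 - r / (t + r)) *\<^sub>R (-r) + (r / (t + r)) *\<^sub>R t = 0"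
      using that by (simp add: field_simps)
    moreover have "1 - r / (t + r) = t / (t + r)"
      using that by (simp add: field_simps)
    ultimately have "0 \<le> t / (t + r) * p (- r) + r / (t + r) * p t"
      using p0 by simp
    then have "0 \<le> (t * p (- r) + r * p t) / (t + r)" by (simp add: add_divide_distrib)
    then have "0 \<le> t * p (- r) + r * p t" using that by (simp add: zero_le_divide_iff)
    then show ?thesis using that by (simp add: field_simps)
  qed
  define s where "s = (INF t\<in>{0<..}. p t / t)"
  have bdd: "bdd_below ((\<lambda>t. p t / t) ` {0<..})"
    using key[of _ 1] by (intro bdd_belowI[of _ "- p (- 1)"]) auto
  have "t * s \<le> p t" for t
  proof (cases t "0::real" rule: linorder_cases)
    case less
    have "- p t / (- t) \<le> s"
      unfolding s_def using less key[of _ "- t"] by (intro cINF_greatest) auto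
    then show ?thesis using less by (simp add: field_simps)
  next
    case equal then show ?thesis using p0 by simp
  next
    case greater
    have "s \<le> p t / t" unfolding s_def using greater by (intro cINF_lower[OF bdd]) auto
    then show ?thesis using greater by (simp add: field_simps)
  qed
  then show ?thesis using that by blast
qed

text \<open>
  Let \<open>s\<close> be a slope of \<open>h\<close> at \<open>0\<close> in the direction \<open>a\<close>. The infimum over \<open>t\<close> of \<open>h (v + t a) - t s\<close> is
  a competitor below \<open>h\<close> which, by the choice of \<open>s\<close>, still vanishes at \<open>0\<close>. If \<open>h\<close> is minimal, the two
  coincide, which says exactly that \<open>h\<close> is affine with slope \<open>s\<close> along every line parallel to \<open>a\<close>.
\<close>

lemma linear_if_minimal_convex:
  fixes h :: "'a::real_normed_vector \<Rightarrow> real"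
  assumes conv: "convex_on UNIV h" and lip: "L-lipschitz_on UNIV h" and h0: "h 0 = 0"
    and min: "\<And>k. convex_on UNIV k \<Longrightarrow> L-lipschitz_on UNIV k \<Longrightarrow> k 0 = 0 \<Longrightarrow> k \<le> h \<Longrightarrow> k = h"
  shows "linear h"
proof -
  have line: "h (v + t *\<^sub>R a) = h v + t * h a" for v a and t :: real
  proof -
    have "convex_on UNIV (\<lambda>t. h (t *\<^sub>R a))"
    proof (rule convex_onI)
      fix t x y :: real assume "0 < t" "t < 1"
      then show "h (((1 - t) *\<^sub>R x + t *\<^sub>R y) *\<^sub>R a) \<le> (1 - t) * h (x *\<^sub>R a) + t * h (y *\<^sub>R a)"
        using convex_onD[OF conv, of t "x *\<^sub>R a" "y *\<^sub>R a"] by (simp add: scaleR_left_distrib)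
    qed simp
    then obtain s where s: "\<And>t. t * s \<le> h (t *\<^sub>R a)"
      using ex_slope_of_convex_vanishing_at_0[of "\<lambda>t. h (t *\<^sub>R a)"] h0 by auto
    define G where "G v t = h (v + t *\<^sub>R a) - t * s" for v and t :: real
    define k where "k v = (INF t. G v t)" for v
    have lb: "- (L * norm v) \<le> G v t" for v t
      using lipschitz_on_real_le[OF lip, of "t *\<^sub>R a" "v + t *\<^sub>R a"] s[of t] by (simp add: G_def)
    have bdd: "bdd_below (range (G v))" for v
      using lb[of v] by (intro bdd_belowI2) auto
    have "convex_on (UNIV \<times> UNIV) (\<lambda>(v, t). G v t)"
    proof (rule convex_onI)
      fix r :: real and x y :: "'a \<times> real" assume r: "0 < r" "r < 1"
      obtain v t where x: "x = (v, t)" by force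
      obtain w q where y: "y = (w, q)" by force
      have "(1 - r) *\<^sub>R v + r *\<^sub>R w + ((1 - r) * t + r * q) *\<^sub>R a
          = (1 - r) *\<^sub>R (v + t *\<^sub>R a) + r *\<^sub>R (w + q *\<^sub>R a)" by (simp add: algebra_simps)
      then show "(case (1 - r) *\<^sub>R x + r *\<^sub>R y of (v, t) \<Rightarrow> G v t)
          \<le> (1 - r) * (case x of (v, t) \<Rightarrow> G v t) + r * (case y of (v, t) \<Rightarrow> G v t)"
        using convex_onD[OF conv, of r "v + t *\<^sub>R a" "w + q *\<^sub>R a"] r
        by (simp add: x y G_def algebra_simps)
    qed simp
    from convex_on_INF_marginal[OF this _ bdd] have kc: "convex_on UNIV k"
      unfolding k_def by simp
    have kl: "L-lipschitz_on UNIV k" unfolding k_def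
    proof (rule lipschitz_on_INF[OF _ _ bdd])
      fix t :: real
      show "L-lipschitz_on UNIV (\<lambda>v. G v t)"
      proof (rule lipschitz_on_realI[OF lipschitz_on_nonneg[OF lip]])
        fix x y show "G x t \<le> G y t + L * norm (x - y)"
          using lipschitz_on_real_le[OF lip, of "x + t *\<^sub>R a" "y + t *\<^sub>R a"] by (simp add: G_def)
      qed
    qed simp
    have up: "k v \<le> G v t" for v t unfolding k_def by (rule cINF_lower[OF bdd]) simp
    have kle: "k \<le> h" using up[of _ 0] by (auto simp: le_fun_def G_def)
    moreover have "0 \<le> k 0" unfolding k_def using s by (intro cINF_greatest) (auto simp: G_def)
    ultimately have "k 0 = 0" using h0 by (metis antisym le_funD)
    then have "k = h" using min kc kl kle by blast
    then have le: "h v \<le> h (v + t *\<^sub>R a) - t * s" for v t using up by (auto simp: G_def)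
    have eq: "h (v + t *\<^sub>R a) = h v + t * s" for v t
      using le[of v t] le[of "v + t *\<^sub>R a" "- t"] by simp
    show ?thesis using eq[of v t] eq[of 0 1] h0 by simp
  qed
  show "linear h"
    using line[of _ 1] line[of 0] h0 by (intro linearI) auto
qed

text \<open>
  A form of the Hahn-Banach theorem. Zorn's lemma yields a minimal \<open>L\<close>-Lipschitz convex function
  vanishing at \<open>0\<close> below the increment \<open>f (x + v) - f x\<close>, and minimality makes it linear. The Lipschitz
  condition serves both as the lower bound that keeps the infima of chains finite and as the bound
  on the norm of the resulting functional.
\<close>

theorem ex_subgradient_of_lipschitz_convex:
  fixes f :: "'a::real_normed_vector \<Rightarrow> real"
  assumes conv: "convex_on UNIV f" and lip: "L-lipschitz_on UNIV f"
  obtains \<phi> :: "'a \<Rightarrow>\<^sub>L real" where "norm \<phi> \<le> L" "\<And>y. f x + \<phi> (y - x) \<le> f y"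
proof -
  define h0 where "h0 v = f (x + v) - f x" for v
  define A where "A = {h. convex_on UNIV h \<and> L-lipschitz_on UNIV h \<and> h 0 = 0 \<and> h \<le> h0}"
  have L: "0 \<le> L" by (rule lipschitz_on_nonneg[OF lip])
  have "convex_on UNIV h0"
  proof (rule convex_onI)
    fix t :: real and v w :: 'a assume t: "0 < t" "t < 1"
    have "x + ((1 - t) *\<^sub>R v + t *\<^sub>R w) = (1 - t) *\<^sub>R (x + v) + t *\<^sub>R (x + w)"
      by (simp add: algebra_simps)
    then show "h0 ((1 - t) *\<^sub>R v + t *\<^sub>R w) \<le> (1 - t) * h0 v + t * h0 w"
      using convex_onD[OF conv, of t "x + v" "x + w"] t by (simp add: h0_def algebra_simps)
  qed simp
  moreover have "L-lipschitz_on UNIV h0"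
  proof (rule lipschitz_on_realI[OF L])
    fix v w show "h0 v \<le> h0 w + L * norm (v - w)"
      using lipschitz_on_real_le[OF lip, of "x + v" "x + w"] by (simp add: h0_def)
  qed
  ultimately have h0A: "h0 \<in> A" by (auto simp: A_def h0_def)
  have "\<exists>m\<in>A. \<forall>k\<in>A. k \<le> m \<longrightarrow> k = m"
  proof (rule predicate_Zorn[of A "\<lambda>a b. b \<le> a"])
    show "partial_order_on A (relation_of (\<lambda>a b. b \<le> a) A)"
      by (rule partial_order_on_relation_ofI) auto
    fix C assume C: "C \<in> Chains (relation_of (\<lambda>a b. b \<le> a) A)"
    show "\<exists>u\<in>A. \<forall>a\<in>C. u \<le> a"
    proof (cases "C = {}")
      case True then show ?thesis using h0A by auto
    next
      case False
      have CA: "C \<subseteq> A" using C by (auto simp: Chains_def relation_of_def)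
      have ch: "h \<le> k \<or> k \<le> h" if "h \<in> C" "k \<in> C" for h k
        using C that by (auto simp: Chains_def relation_of_def)
      define u where "u v = (INF h\<in>C. h v)" for v
      have bdd: "bdd_below ((\<lambda>h. h v) ` C)" for v
      proof (rule bdd_belowI2)
        fix h assume "h \<in> C"
        then show "- (L * norm v) \<le> h v"
          using CA lipschitz_on_real_le[of L h 0 v] by (auto simp: A_def)
      qed
      have "convex_on UNIV u" unfolding u_def
        using CA by (intro convex_on_INF_chain ch False bdd) (auto simp: A_def)
      moreover have "L-lipschitz_on UNIV u" unfolding u_def
        using CA by (intro lipschitz_on_INF False bdd) (auto simp: A_def)
      moreover have "u 0 = 0"
      proof -
        have "(\<lambda>h. h 0) ` C = {0}" using CA False by (force simp: A_def)
        then show ?thesis by (simp add: u_def)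
      qed
      moreover have ule: "u \<le> h" if "h \<in> C" for h
        unfolding u_def le_fun_def using that bdd by (auto intro: cINF_lower)
      moreover have "u \<le> h0" 
      proof -
        obtain h where "h \<in> C" using False by auto
        then show ?thesis using ule CA by (force simp: A_def intro: order_trans)
      qed
      ultimately show ?thesis by (auto simp: A_def)
    qed
  qed
  then obtain h where hA: "h \<in> A" and min: "\<And>k. k \<in> A \<Longrightarrow> k \<le> h \<Longrightarrow> k = h" by auto
  have lin: "linear h"
  proof (rule linear_if_minimal_convex)
    show "convex_on UNIV h" "L-lipschitz_on UNIV h" "h 0 = 0" using hA by (auto simp: A_def)
    fix k :: "'a \<Rightarrow> real"
    assume "convex_on UNIV k" "L-lipschitz_on UNIV k" "k 0 = 0" "k \<le> h"
    then show "k = h" using hA by (intro min) (auto simp: A_def intro: order_trans)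
  qed
  have hb: "\<bar>h v\<bar> \<le> L * norm v" for v
    using hA lipschitz_on_real_le[of L h 0 v] lipschitz_on_real_le[of L h v 0]
    by (auto simp: A_def)
  have "bounded_linear h"
    using lin hb by (intro bounded_linear_intro[where K = L])
      (auto simp: linear_add linear_scale mult.commute)
  then have app: "blinfun_apply (Blinfun h) = h" by (rule bounded_linear_Blinfun_apply)
  show ?thesis
  proof
    show "norm (Blinfun h) \<le> L" using L hb by (intro norm_blinfun_bound) (auto simp: app)
    fix y
    have "h (y - x) \<le> h0 (y - x)" using hA by (auto simp: A_def le_fun_def)
    then show "f x + Blinfun h (y - x) \<le> f y" by (simp add: app h0_def)
  qed
qed

section \<open>A rotund penalty on balls of a separable dual\<close>

text \<open>
  Sequences suffice here, because the weak-star topology is metrizable on balls of the dual of a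
  separable space.
\<close>

definition weak_star_lsc_on :: "('a::real_normed_vector \<Rightarrow>\<^sub>L real) set \<Rightarrow> (('a \<Rightarrow>\<^sub>L real) \<Rightarrow> real) \<Rightarrow> bool" where
  "weak_star_lsc_on K u \<longleftrightarrow> (\<forall>F \<phi>. range F \<subseteq> K \<and> \<phi> \<in> K \<and> (\<forall>y. (\<lambda>k. F k y) \<longlonglongrightarrow> blinfun_apply \<phi> y)
     \<longrightarrow> (\<forall>e>0. \<forall>\<^sub>F k in sequentially. u \<phi> - e < u (F k)))"

text \<open>
  The gap is nonnegative for convex \<open>u\<close>; how fast it grows as \<open>\<phi>\<close> and \<open>\<psi>\<close> separate measures the
  rotundity of \<open>u\<close>.
\<close>

definition midpoint_gap :: "('a::real_vector \<Rightarrow> real) \<Rightarrow> 'a \<Rightarrow> 'a \<Rightarrow> real" where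
  "midpoint_gap u \<phi> \<psi> = (u \<phi> + u \<psi>) / 2 - u ((1/2) *\<^sub>R (\<phi> + \<psi>))"

lemma weak_star_lsc_onD:
  assumes "weak_star_lsc_on K u" "\<And>k. F k \<in> K" "\<phi> \<in> K"
    "\<And>y. (\<lambda>k. F k y) \<longlonglongrightarrow> blinfun_apply \<phi> y" "0 < e"
  shows "\<forall>\<^sub>F k in sequentially. u \<phi> - e < u (F k)"
  using assms unfolding weak_star_lsc_on_def by blast

text \<open>
  The dual norm is a supremum of evaluations, and a single vector \<open>x\<close> that nearly attains it at
  \<open>\<phi> - b\<close> bounds the norms of \<open>F k - b\<close> from below once \<open>F k x\<close> is close to \<open>\<phi> x\<close>.
\<close>

lemma weak_star_lsc_on_norm_diff: "weak_star_lsc_on K (\<lambda>\<phi>. norm (\<phi> - b))"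
  unfolding weak_star_lsc_on_def
proof (intro allI impI, elim conjE)
  fix F :: "nat \<Rightarrow> 'a \<Rightarrow>\<^sub>L real" and \<phi> and e :: real
  assume lim: "\<forall>y. (\<lambda>k. F k y) \<longlonglongrightarrow> blinfun_apply \<phi> y" and e: "0 < e"
  let ?c = "norm (\<phi> - b) - e"
  show "\<forall>\<^sub>F k in sequentially. ?c < norm (F k - b)"
  proof (cases "?c < 0")
    case True
    have "?c < norm (F k - b)" for k
      using True norm_ge_zero[of "F k - b"] by linarith
    then show ?thesis by simp
  next
    case False
    then have "\<not> (\<forall>x. norm ((\<phi> - b) x) \<le> ?c * norm x)"
      using norm_blinfun_bound[of ?c "\<phi> - b"] e by auto
    then obtain x where x: "?c * norm x < norm ((\<phi> - b) x)"
      by (auto simp: not_le)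
    have "(\<lambda>k. norm ((F k - b) x)) \<longlonglongrightarrow> norm ((\<phi> - b) x)"
      unfolding blinfun.diff_left using lim by (intro tendsto_norm tendsto_diff tendsto_const) auto
    then have "\<forall>\<^sub>F k in sequentially. ?c * norm x < norm ((F k - b) x)"
      using x by (rule order_tendstoD)
    then show ?thesis
    proof eventually_elim
      case (elim k)
      then have "?c * norm x < norm (F k - b) * norm x"
        using norm_blinfun[of "F k - b" x] by linarith
      then show ?case by (simp add: mult_less_cancel_right)
    qed
  qed
qed

lemma weak_star_lsc_on_eval: "weak_star_lsc_on K (\<lambda>\<phi>. blinfun_apply \<phi> a)"
  unfolding weak_star_lsc_on_def by (auto intro: order_tendstoD)

lemma weak_star_lsc_on_affine:
  assumes "weak_star_lsc_on K u" "0 < c"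
  shows "weak_star_lsc_on K (\<lambda>\<phi>. (u \<phi> + d) / c)"
  unfolding weak_star_lsc_on_def
proof (intro allI impI, elim conjE)
  fix F \<phi> and e :: real
  assume "range F \<subseteq> K" "\<phi> \<in> K" "\<forall>y. (\<lambda>k. F k y) \<longlonglongrightarrow> blinfun_apply \<phi> y" "0 < e"
  then have "\<forall>\<^sub>F k in sequentially. u \<phi> - c * e < u (F k)"
    using assms by (intro weak_star_lsc_onD[OF assms(1)]) auto
  then show "\<forall>\<^sub>F k in sequentially. (u \<phi> + d) / c - e < (u (F k) + d) / c"
  proof eventually_elim
    case (elim k)
    have "(u \<phi> + d) / c - e = (u \<phi> - c * e + d) / c"
      using assms(2) by (simp add: field_simps)
    also have "\<dots> < (u (F k) + d) / c"
      using elim assms(2) by (intro divide_strict_right_mono) auto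
    finally show ?case .
  qed
qed

definition weighted_square_sum :: "(nat \<Rightarrow> 'a \<Rightarrow> real) \<Rightarrow> 'a \<Rightarrow> real" where
  "weighted_square_sum u \<phi> = (\<Sum>n. (1/2) ^ Suc n * (u n \<phi>)\<^sup>2)"

lemma weighted_square_sum:
  assumes "\<And>n. 0 \<le> u n \<phi>" "\<And>n. u n \<phi> \<le> 1"
  shows weighted_square_sum_sums:
      "(\<lambda>n. (1/2) ^ Suc n * (u n \<phi>)\<^sup>2) sums weighted_square_sum u \<phi>"
    and weighted_square_sum_nonneg: "0 \<le> weighted_square_sum u \<phi>"
    and weighted_square_sum_le_1: "weighted_square_sum u \<phi> \<le> 1"
proof -
  have sq: "(u n \<phi>)\<^sup>2 \<le> 1" for n using assms by (simp add: power_le_one)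
  have geo: "(\<lambda>n. (1/2::real) ^ Suc n) sums 1"
    using power_half_series by simp
  have "summable (\<lambda>n. (1/2) ^ Suc n * (u n \<phi>)\<^sup>2)"
    by (rule summable_comparison_test'[OF sums_summable[OF geo], of 0]) (use sq in \<open>auto simp: field_simps\<close>)
  then show s: "(\<lambda>n. (1/2) ^ Suc n * (u n \<phi>)\<^sup>2) sums weighted_square_sum u \<phi>"
    unfolding weighted_square_sum_def by (rule summable_sums)
  show "0 \<le> weighted_square_sum u \<phi>"
    by (rule sums_le[OF _ sums_zero s]) auto
  show "weighted_square_sum u \<phi> \<le> 1"
    by (rule sums_le[OF _ s geo]) (use sq in \<open>auto simp: field_simps\<close>)
qed

text \<open>
  The square is uniformly convex: \<open>(a\<^sup>2 + b\<^sup>2) / 2 - ((a + b) / 2)\<^sup>2 = (a - b)\<^sup>2 / 4\<close>. Since every term of the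
  series has a nonnegative gap, the gap of the sum controls the difference of each single \<open>u n\<close>.
\<close>

lemma midpoint_gap_weighted_square_sum:
  assumes conv: "\<And>n. convex_on K (u n)"
    and ge0: "\<And>n \<phi>. \<phi> \<in> K \<Longrightarrow> 0 \<le> u n \<phi>" and le1: "\<And>n \<phi>. \<phi> \<in> K \<Longrightarrow> u n \<phi> \<le> 1"
    and \<phi>: "\<phi> \<in> K" and \<psi>: "\<psi> \<in> K"
  shows "(1/2) ^ Suc n * (u n \<phi> - u n \<psi>)\<^sup>2 / 4 \<le> midpoint_gap (weighted_square_sum u) \<phi> \<psi>"
proof -
  let ?m = "(1/2) *\<^sub>R (\<phi> + \<psi>)"
  let ?w = "\<lambda>n. (1/2::real) ^ Suc n"
  have m: "?m \<in> K"
    using convexD[OF convex_on_imp_convex[OF conv] \<phi> \<psi>, of "1/2" "1/2"] by (simp add: scaleR_add_right)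
  have gap: "(u k \<phi> - u k \<psi>)\<^sup>2 / 4 \<le> ((u k \<phi>)\<^sup>2 + (u k \<psi>)\<^sup>2) / 2 - (u k ?m)\<^sup>2" for k
  proof -
    have "u k ?m \<le> (u k \<phi> + u k \<psi>) / 2"
      using convex_onD[OF conv[of k], of "1/2" \<phi> \<psi>] \<phi> \<psi> by (simp add: scaleR_add_right)
    then have "(u k ?m)\<^sup>2 \<le> ((u k \<phi> + u k \<psi>) / 2)\<^sup>2"
      using ge0[OF m] by (intro power_mono) auto
    then show ?thesis by (simp add: power2_eq_square field_simps)
  qed
  let ?t = "\<lambda>k. (?w k * (u k \<phi>)\<^sup>2 + ?w k * (u k \<psi>)\<^sup>2) / 2 - ?w k * (u k ?m)\<^sup>2"
  have t: "?t k = ?w k * (((u k \<phi>)\<^sup>2 + (u k \<psi>)\<^sup>2) / 2 - (u k ?m)\<^sup>2)" for k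
    by (simp add: algebra_simps)
  have tg: "?w k * (u k \<phi> - u k \<psi>)\<^sup>2 / 4 \<le> ?t k" for k
    unfolding t using mult_left_mono[OF gap[of k], of "?w k"] by simp
  have "?t sums midpoint_gap (weighted_square_sum u) \<phi> \<psi>"
    unfolding midpoint_gap_def
    by (intro sums_diff sums_add sums_divide weighted_square_sum_sums ge0 le1 \<phi> \<psi> m)
  moreover have "0 \<le> ?t k" for k
  proof -
    have "0 \<le> ?w k * (u k \<phi> - u k \<psi>)\<^sup>2 / 4" by simp
    then show ?thesis using tg[of k] by (rule order_trans)
  qed
  ultimately have "?t n \<le> midpoint_gap (weighted_square_sum u) \<phi> \<psi>"
    using sum_le_suminf[of ?t "{n}"] sums_summable sums_unique by fastforce
  then show ?thesis by (rule order_trans[OF tg])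
qed

text \<open>
  A finite partial sum captures all but \<open>e / 2\<close> of the value at the limit point, and the terms omitted
  from it at the points of the sequence are nonnegative.
\<close>

lemma weak_star_lsc_on_weighted_square_sum:
  assumes lsc: "\<And>n. weak_star_lsc_on K (u n)"
    and ge0: "\<And>n \<phi>. \<phi> \<in> K \<Longrightarrow> 0 \<le> u n \<phi>" and le1: "\<And>n \<phi>. \<phi> \<in> K \<Longrightarrow> u n \<phi> \<le> 1"
  shows "weak_star_lsc_on K (weighted_square_sum u)"
  unfolding weak_star_lsc_on_def
proof (intro allI impI, elim conjE)
  fix F \<phi> and e :: real
  assume F: "range F \<subseteq> K" and \<phi>: "\<phi> \<in> K"
    and lim: "\<forall>y. (\<lambda>k. F k y) \<longlonglongrightarrow> blinfun_apply \<phi> y" and e: "0 < e"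
  let ?w = "\<lambda>n. (1/2::real) ^ Suc n"
  let ?S = "\<lambda>\<phi> N. \<Sum>n<N. ?w n * (u n \<phi>)\<^sup>2"
  have FK: "F k \<in> K" for k using F by auto
  have "(\<lambda>N. ?S \<phi> N) \<longlonglongrightarrow> weighted_square_sum u \<phi>"
    using weighted_square_sum_sums[of u \<phi>] ge0 le1 \<phi> by (simp add: sums_def)
  then have "\<forall>\<^sub>F N in sequentially. weighted_square_sum u \<phi> - e / 2 < ?S \<phi> N"
    by (rule order_tendstoD) (use e in simp)
  then obtain N where N: "weighted_square_sum u \<phi> - e / 2 < ?S \<phi> N"
    by (auto simp: eventually_sequentially)
  have "\<forall>\<^sub>F k in sequentially. \<forall>n\<in>{..<N}. u n \<phi> - e / 4 < u n (F k)"
    by (intro eventually_ball_finite ballI weak_star_lsc_onD[OF lsc] FK \<phi>) (use lim e in auto)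
  then show "\<forall>\<^sub>F k in sequentially. weighted_square_sum u \<phi> - e < weighted_square_sum u (F k)"
  proof eventually_elim
    case (elim k)
    have sq: "(u n \<phi>)\<^sup>2 - e / 2 \<le> (u n (F k))\<^sup>2" if "n < N" for n
    proof (cases "u n \<phi> \<le> u n (F k)")
      case True
      then have "(u n \<phi>)\<^sup>2 \<le> (u n (F k))\<^sup>2" using ge0[OF \<phi>] by (intro power_mono)
      then show ?thesis using e by simp
    next
      case False
      have "(u n \<phi> - u n (F k)) * (u n \<phi> + u n (F k)) \<le> e / 4 * 2"
        using False elim that le1[OF \<phi>, of n] le1[OF FK, of n k] ge0[OF \<phi>, of n] ge0[OF FK, of n k] e
        by (intro mult_mono) force+
      then show ?thesis by (simp add: power2_eq_square algebra_simps)
    qed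
    have "?S \<phi> N - e / 2 * (\<Sum>n<N. ?w n) \<le> ?S (F k) N"
      unfolding sum_distrib_left sum_subtractf[symmetric]
    proof (rule sum_mono)
      fix n assume "n \<in> {..<N}"
      then show "?w n * (u n \<phi>)\<^sup>2 - e / 2 * ?w n \<le> ?w n * (u n (F k))\<^sup>2"
        using mult_left_mono[OF sq, of n "?w n"] by (simp add: algebra_simps)
    qed
    moreover have "(\<Sum>n<N. ?w n) \<le> 1"
      using sum_le_suminf[of ?w "{..<N}"] power_half_series
      by (auto simp: sums_iff)
    then have "e / 2 * (\<Sum>n<N. ?w n) \<le> e / 2" using e by (simp add: mult_le_cancel_left1)
    moreover have "?S (F k) N \<le> weighted_square_sum u (F k)"
      using sum_le_suminf[of "\<lambda>n. ?w n * (u n (F k))\<^sup>2" "{..<N}"]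
        weighted_square_sum_sums[of u "F k"] ge0 le1 FK by (auto simp: sums_iff)
    ultimately show ?case using N by linarith
  qed
qed

lemma ex_dense_sequence:
  assumes "separable_space (euclidean :: 'a::metric_space topology)"
  obtains a :: "nat \<Rightarrow> 'a::metric_space" where "\<And>x e. 0 < e \<Longrightarrow> \<exists>n. dist x (a n) < e"
proof -
  obtain C :: "'a set" where C: "countable C" "closure C = UNIV"
    using assms by (auto simp: separable_space_def)
  have "C \<noteq> {}" using C by auto
  then have "range (from_nat_into C) = C" using C by (simp add: range_from_nat_into)
  moreover have "\<exists>y\<in>C. dist x y < e" if "0 < e" for x e
    using C(2) that closure_approachable[of x C] by (metis UNIV_I dist_commute)
  ultimately show ?thesis using that[of "from_nat_into C"] by (metis imageE)
qed

text \<open>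
  Equicontinuity extends convergence from a dense sequence to all points.
\<close>

lemma pointwise_limit_blinfun:
  fixes F :: "nat \<Rightarrow> 'a::real_normed_vector \<Rightarrow>\<^sub>L real"
  assumes dense: "\<And>x e. 0 < e \<Longrightarrow> \<exists>n. dist x (a n) < e"
    and bound: "\<And>k. norm (F k) \<le> L" and cau: "\<And>n. Cauchy (\<lambda>k. F k (a n))"
  shows "\<exists>\<phi>. norm \<phi> \<le> L \<and> (\<forall>y. (\<lambda>k. F k y) \<longlonglongrightarrow> blinfun_apply \<phi> y)"
proof -
  have L: "0 \<le> L" using bound[of 0] norm_ge_zero order_trans by blast
  have Fb: "\<bar>F k y\<bar> \<le> L * norm y" for k y
    using norm_blinfun[of "F k" y] mult_right_mono[OF bound[of k] norm_ge_zero[of y]] by simp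
  have "convergent (\<lambda>k. F k y)" for y
  proof -
    have "Cauchy (\<lambda>k. F k y)"
    proof (rule CauchyI)
      fix e :: real assume e: "0 < e"
      obtain n where n: "dist y (a n) < e / (4 * (L + 1))"
        using dense[of "e / (4 * (L + 1))" y] e L by auto
      have d: "\<bar>F k y - F k (a n)\<bar> \<le> e / 4" for k
      proof -
        have "\<bar>F k y - F k (a n)\<bar> \<le> L * norm (y - a n)"
          using Fb[of k "y - a n"] by (simp add: blinfun.diff_right)
        also have "\<dots> \<le> (L + 1) * (e / (4 * (L + 1)))"
          using n L by (intro mult_mono) (auto simp: dist_norm)
        also have "\<dots> = e / 4" using L by (simp add: divide_simps add_nonneg_eq_0_iff)
        finally show ?thesis .
      qed
      obtain M where M: "\<And>k l. k \<ge> M \<Longrightarrow> l \<ge> M \<Longrightarrow> \<bar>F k (a n) - F l (a n)\<bar> < e / 2"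
        using CauchyD[OF cau[of n], of "e / 2"] e by auto
      have "norm (F k y - F l y) < e" if "k \<ge> M" "l \<ge> M" for k l
        using M[OF that] d[of k] d[of l] unfolding real_norm_def abs_less_iff abs_le_iff by linarith
      then show "\<exists>M. \<forall>k\<ge>M. \<forall>l\<ge>M. norm (F k y - F l y) < e" by blast
    qed
    then show ?thesis by (simp add: Cauchy_convergent_iff)
  qed
  then obtain h where h: "\<And>y. (\<lambda>k. F k y) \<longlonglongrightarrow> h y"
    unfolding convergent_def by metis
  have hb: "\<bar>h y\<bar> \<le> L * norm y" for y
    by (rule LIMSEQ_le_const2[OF tendsto_rabs[OF h]]) (use Fb in auto)
  have "bounded_linear h"
  proof (rule bounded_linear_intro[where K = L])
    show "h (x + y) = h x + h y" for x y
      using LIMSEQ_unique[OF h[of "x + y"]] tendsto_add[OF h[of x] h[of y]]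
      by (simp add: blinfun.add_right)
    show "h (r *\<^sub>R x) = r *\<^sub>R h x" for r x
      using LIMSEQ_unique[OF h[of "r *\<^sub>R x"]] tendsto_mult_left[OF h[of x], of r]
      by (simp add: blinfun.scaleR_right)
    show "norm (h x) \<le> norm x * L" for x using hb by (simp add: mult.commute)
  qed
  then have app: "blinfun_apply (Blinfun h) = h" by (rule bounded_linear_Blinfun_apply)
  show ?thesis
  proof (intro exI conjI allI)
    show "norm (Blinfun h) \<le> L" using L hb by (intro norm_blinfun_bound) (auto simp: app)
    show "(\<lambda>k. F k y) \<longlonglongrightarrow> blinfun_apply (Blinfun h) y" for y using h by (simp add: app)
  qed
qed

text \<open>
  The two consequences of a small gap that the smoothing argument needs: the first provides pointwise
  limits of maximising sequences, and the second is local uniform rotundity with respect to the norm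
  of the dual.
\<close>

definition strongly_rotund_on :: "('a::real_normed_vector \<Rightarrow>\<^sub>L real) set \<Rightarrow> (('a \<Rightarrow>\<^sub>L real) \<Rightarrow> real) \<Rightarrow> bool" where
  "strongly_rotund_on K \<theta> \<longleftrightarrow>
     (\<forall>F. range F \<subseteq> K \<and>
          (\<forall>e>0. \<exists>N::nat. \<forall>k\<ge>N. \<forall>l\<ge>N. midpoint_gap \<theta> (F k) (F l) < e) \<longrightarrow>
        (\<exists>\<phi>\<in>K. \<forall>y. (\<lambda>k. F k y) \<longlonglongrightarrow> blinfun_apply \<phi> y)) \<and>
     (\<forall>\<phi>\<in>K. \<forall>e>0. \<exists>\<alpha>>0. \<forall>\<psi>\<in>K. midpoint_gap \<theta> \<phi> \<psi> < \<alpha> \<longrightarrow> norm (\<psi> - \<phi>) < e)"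

text \<open>
  The even-numbered functions \<open>u n\<close> are the normalised distances to a dense sequence in the dual and
  give norm convergence; the odd-numbered ones are the normalised evaluations at a dense sequence in
  the space and give pointwise convergence.
\<close>

theorem ex_rotund_penalty:
  assumes sepX: "separable_space (euclidean :: 'a::real_normed_vector topology)"
    and sepD: "separable_space (euclidean :: ('a \<Rightarrow>\<^sub>L real) topology)"
    and L: "0 \<le> L"
  obtains \<theta> :: "('a::real_normed_vector \<Rightarrow>\<^sub>L real) \<Rightarrow> real" where
    "\<And>\<phi>. \<phi> \<in> cball 0 L \<Longrightarrow> 0 \<le> \<theta> \<phi>" "\<And>\<phi>. \<phi> \<in> cball 0 L \<Longrightarrow> \<theta> \<phi> \<le> 1"
    "weak_star_lsc_on (cball 0 L) \<theta>"
    "strongly_rotund_on (cball 0 L) \<theta>"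
proof -
  obtain a :: "nat \<Rightarrow> 'a" where a: "\<And>x e. 0 < e \<Longrightarrow> \<exists>n. dist x (a n) < e"
    using ex_dense_sequence[OF sepX] by blast
  obtain b :: "nat \<Rightarrow> 'a \<Rightarrow>\<^sub>L real" where b: "\<And>x e. 0 < e \<Longrightarrow> \<exists>n. dist x (b n) < e"
    using ex_dense_sequence[OF sepD] by blast
  define K :: "('a \<Rightarrow>\<^sub>L real) set" where "K = cball 0 L"
  define p where "p n \<phi> = norm (\<phi> - b n) / (L + norm (b n) + 1)" for n \<phi>
  define q where "q n \<phi> = (blinfun_apply \<phi> (a n) + L * norm (a n)) / (2 * L * norm (a n) + 1)" for n \<phi>
  define u where "u n = (if even n then p (n div 2) else q (n div 2))" for n
  define \<theta> where "\<theta> = weighted_square_sum u"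
  have pd: "0 < L + norm (b n) + 1" for n using L norm_ge_zero[of "b n"] by linarith
  have qd: "0 < 2 * L * norm (a n) + 1" for n using L by (simp add: add_nonneg_pos)
  have Kc: "convex K" by (simp add: K_def)
  have ev: "\<bar>blinfun_apply \<phi> x\<bar> \<le> L * norm x" if "\<phi> \<in> K" for \<phi> x
    using norm_blinfun[of \<phi> x] mult_right_mono[of "norm \<phi>" L "norm x"] that by (simp add: K_def)
  have p01: "0 \<le> p n \<phi> \<and> p n \<phi> \<le> 1" if "\<phi> \<in> K" for n \<phi>
    using that norm_triangle_ineq4[of \<phi> "b n"] pd[of n] by (auto simp: p_def K_def field_simps)
  have q01: "0 \<le> q n \<phi> \<and> q n \<phi> \<le> 1" if "\<phi> \<in> K" for n \<phi>
    using ev[OF that, of "a n"] qd[of n] by (auto simp: q_def abs_le_iff field_simps)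
  have u01: "0 \<le> u n \<phi>" "u n \<phi> \<le> 1" if "\<phi> \<in> K" for n \<phi>
    using p01[OF that] q01[OF that] by (auto simp: u_def)
  have pconv: "convex_on K (p n)" for n
  proof -
    have "convex_on K (\<lambda>\<phi>. dist (b n) \<phi> / (L + norm (b n) + 1))"
      using pd[of n] Kc by (intro convex_on_cdiv convex_on_dist) auto
    then show ?thesis unfolding p_def by (simp add: dist_norm norm_minus_commute)
  qed
  have qconv: "convex_on K (q n)" for n
    unfolding q_def using qd[of n] 
    by (intro convex_on_cdiv convex_onI[OF _ Kc])
       (auto simp: blinfun.bilinear_simps algebra_simps)
  have uconv: "convex_on K (u n)" for n using pconv qconv by (auto simp: u_def)
  have plsc: "weak_star_lsc_on K (p n)" for n
    using weak_star_lsc_on_affine[OF weak_star_lsc_on_norm_diff pd, where d = 0]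
    by (simp add: p_def[abs_def])
  have qlsc: "weak_star_lsc_on K (q n)" for n
    unfolding q_def by (rule weak_star_lsc_on_affine[OF weak_star_lsc_on_eval qd])
  have ulsc: "weak_star_lsc_on K (u n)" for n using plsc qlsc by (auto simp: u_def)
  have gap: "(1/2) ^ Suc n * (u n \<phi> - u n \<psi>)\<^sup>2 / 4 \<le> midpoint_gap \<theta> \<phi> \<psi>"
    if "\<phi> \<in> K" "\<psi> \<in> K" for n \<phi> \<psi>
    unfolding \<theta>_def by (rule midpoint_gap_weighted_square_sum[where K = K, OF uconv u01 that])
  have close: "\<bar>u n \<phi> - u n \<psi>\<bar> < e"
    if "\<phi> \<in> K" "\<psi> \<in> K" "0 < e" "midpoint_gap \<theta> \<phi> \<psi> < (1/2) ^ Suc n * e\<^sup>2 / 4" for n \<phi> \<psi> e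
  proof -
    have "(1/2) ^ Suc n * (u n \<phi> - u n \<psi>)\<^sup>2 / 4 < (1/2) ^ Suc n * e\<^sup>2 / 4"
      using gap[OF that(1,2), of n] that(4) by linarith
    then have "(u n \<phi> - u n \<psi>)\<^sup>2 < e\<^sup>2" by simp
    then have "\<bar>u n \<phi> - u n \<psi>\<bar>\<^sup>2 < e\<^sup>2" by simp
    then show ?thesis by (rule power2_less_imp_less) (use that(3) in simp)
  qed
  show ?thesis
  proof (rule that[of \<theta>])
    show "0 \<le> \<theta> \<phi>" "\<theta> \<phi> \<le> 1" if "\<phi> \<in> cball 0 L" for \<phi>
      using weighted_square_sum_nonneg[of u \<phi>] weighted_square_sum_le_1[of u \<phi>] u01[of \<phi>] that
      by (auto simp: \<theta>_def K_def)
    show "weak_star_lsc_on (cball 0 L) \<theta>"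
      using weak_star_lsc_on_weighted_square_sum[of K u, OF ulsc u01] by (simp add: \<theta>_def K_def)
    show "strongly_rotund_on (cball 0 L) \<theta>"
      unfolding strongly_rotund_on_def K_def[symmetric]
    proof (intro conjI allI impI ballI, elim conjE)
      fix F :: "nat \<Rightarrow> 'a \<Rightarrow>\<^sub>L real"
      assume F: "range F \<subseteq> K"
        and cau: "\<forall>e>0. \<exists>N::nat. \<forall>k\<ge>N. \<forall>l\<ge>N. midpoint_gap \<theta> (F k) (F l) < e"
      have FK: "F k \<in> K" for k using F by auto
      then have FL: "norm (F k) \<le> L" for k by (simp add: K_def)
      have aF: "Cauchy (\<lambda>k. F k (a n))" for n
      proof (rule CauchyI)
        fix e :: real assume e: "0 < e"
        define r where "r = e / (2 * L * norm (a n) + 1)"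
        have r: "0 < r" using e qd by (simp add: r_def)
        have un: "u (Suc (2 * n)) = q n" by (simp add: u_def)
        obtain N where N: "\<forall>k\<ge>N. \<forall>l\<ge>N. midpoint_gap \<theta> (F k) (F l) < (1/2) ^ Suc (Suc (2 * n)) * r\<^sup>2 / 4"
          using cau[rule_format, of "(1/2) ^ Suc (Suc (2 * n)) * r\<^sup>2 / 4"] r by auto
        have "norm (F k (a n) - F l (a n)) < e" if "N \<le> k" "N \<le> l" for k l
        proof -
          have "\<bar>q n (F k) - q n (F l)\<bar> < r"
            using close[OF FK FK r, of k l "Suc (2 * n)"] N that unfolding un by blast
          moreover have "q n (F k) - q n (F l) = (F k (a n) - F l (a n)) / (2 * L * norm (a n) + 1)"
            by (simp add: q_def diff_divide_distrib add_divide_distrib)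
          ultimately show ?thesis
            using qd[of n] by (simp add: r_def abs_divide divide_less_cancel)
        qed
        then show "\<exists>N. \<forall>k\<ge>N. \<forall>l\<ge>N. norm (F k (a n) - F l (a n)) < e" by blast
      qed
      show "\<exists>\<phi>\<in>K. \<forall>y. (\<lambda>k. F k y) \<longlonglongrightarrow> blinfun_apply \<phi> y"
        using pointwise_limit_blinfun[of a F L, OF a FL aF] by (simp add: K_def Bex_def)
    next
      fix \<phi> :: "'a \<Rightarrow>\<^sub>L real" and e :: real
      assume \<phi>: "\<phi> \<in> K" and e: "0 < e"
      define \<rho> where "\<rho> = e / 3"
      have \<rho>: "0 < \<rho>" using e by (simp add: \<rho>_def)
      \<comment> \<open>If \<open>b n\<close> is close to \<open>\<phi>\<close> and \<open>\<psi>\<close> has almost the same distance to \<open>b n\<close> as \<open>\<phi>\<close>, then \<open>\<psi>\<close> is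
        close to \<open>b n\<close> as well, and hence to \<open>\<phi>\<close>.\<close>
      obtain n where n: "dist \<phi> (b n) < \<rho>" using b[OF \<rho>] by blast
      define r where "r = \<rho> / (L + norm (b n) + 1)"
      have r: "0 < r" using \<rho> pd by (simp add: r_def)
      have un: "u (2 * n) = p n" by (simp add: u_def)
      have "norm (\<psi> - \<phi>) < e"
        if \<psi>: "\<psi> \<in> K" "midpoint_gap \<theta> \<phi> \<psi> < (1/2) ^ Suc (2 * n) * r\<^sup>2 / 4" for \<psi>
      proof -
        have "\<bar>p n \<phi> - p n \<psi>\<bar> < r"
          using close[of \<phi> \<psi> r "2 * n"] r \<phi> \<psi> unfolding un by simp
        moreover have "p n \<phi> - p n \<psi> = (norm (\<phi> - b n) - norm (\<psi> - b n)) / (L + norm (b n) + 1)"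
          by (simp add: p_def diff_divide_distrib)
        ultimately have "\<bar>norm (\<phi> - b n) - norm (\<psi> - b n)\<bar> < \<rho>"
          using pd[of n] by (simp add: r_def abs_divide divide_less_cancel)
        moreover have "norm (\<psi> - \<phi>) \<le> norm (\<psi> - b n) + norm (\<phi> - b n)"
          using norm_triangle_ineq4[of "\<psi> - b n" "\<phi> - b n"] by simp
        ultimately show ?thesis using n unfolding dist_norm \<rho>_def abs_less_iff by linarith
      qed
      then show "\<exists>\<alpha>>0. \<forall>\<psi>\<in>K. midpoint_gap \<theta> \<phi> \<psi> < \<alpha> \<longrightarrow> norm (\<psi> - \<phi>) < e"
        using r by (intro exI[of _ "(1/2) ^ Suc (2 * n) * r\<^sup>2 / 4"]) auto
    qed
  qed
qed

section \<open>Smoothing Lipschitz convex functions\<close>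

text \<open>
  The pairs \<open>(\<phi>, c)\<close> in \<open>B\<close> stand for the affine functions \<open>\<phi> - c\<close>, and \<open>g\<close> is their supremum. The function
  that is optimal at \<open>y\<close> is nearly optimal at each nearby \<open>x\<close>, so the strong form of attainment makes
  \<open>\<Phi>\<close> continuous. Comparing the tangents at \<open>x\<close> and \<open>y\<close> squeezes \<open>g y - g x - \<Phi> x (y - x)\<close> between \<open>0\<close>
  and \<open>(\<Phi> y - \<Phi> x) (y - x)\<close>.
\<close>

lemma C1_on_strongly_attained_supremum:
  fixes B :: "(('a::real_normed_vector \<Rightarrow>\<^sub>L real) \<times> real) set" and g :: "'a \<Rightarrow> real"
    and \<Phi> :: "'a \<Rightarrow> 'a \<Rightarrow>\<^sub>L real"
  assumes bound: "\<And>\<phi> c. (\<phi>, c) \<in> B \<Longrightarrow> norm \<phi> \<le> L"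
    and upper: "\<And>\<phi> c x. (\<phi>, c) \<in> B \<Longrightarrow> blinfun_apply \<phi> x - c \<le> g x"
    and attained: "\<And>x. (\<Phi> x, \<Phi> x x - g x) \<in> B"
    and strong: "\<And>x e. 0 < e \<Longrightarrow>
      \<exists>\<alpha>>0. \<forall>\<phi> c. (\<phi>, c) \<in> B \<longrightarrow> g x - \<alpha> < blinfun_apply \<phi> x - c \<longrightarrow> norm (\<phi> - \<Phi> x) < e"
  shows "C1_on UNIV g"
proof -
  have L: "0 \<le> L" using bound[OF attained] norm_ge_zero order_trans by blast
  have tangent: "g x + \<Phi> x (y - x) \<le> g y" for x y
    using upper[OF attained[of x], of y] by (simp add: blinfun.diff_right)
  have \<Phi>b: "\<bar>\<Phi> y v\<bar> \<le> L * norm v" for y v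
    using norm_blinfun[of "\<Phi> y" v] mult_right_mono[OF bound[OF attained], of "norm v" y] by simp
  have cont: "\<exists>d>0. \<forall>y. norm (y - x) < d \<longrightarrow> norm (\<Phi> y - \<Phi> x) < e" if e: "0 < e" for x e
  proof -
    obtain \<alpha> where \<alpha>: "0 < \<alpha>"
      "\<And>\<phi> c. (\<phi>, c) \<in> B \<Longrightarrow> g x - \<alpha> < blinfun_apply \<phi> x - c \<Longrightarrow> norm (\<phi> - \<Phi> x) < e"
      using strong[OF e, of x] by blast
    define d where "d = \<alpha> / (2 * L + 1)"
    have d: "0 < d" "2 * L * d < \<alpha>" using \<alpha>(1) L by (auto simp: d_def field_simps add_pos_nonneg)
    have "norm (\<Phi> y - \<Phi> x) < e" if y: "norm (y - x) < d" for y
    proof (rule \<alpha>(2)[OF attained])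
      have "2 * (L * norm (y - x)) \<le> 2 * (L * d)"
        using y L by (intro mult_left_mono) auto
      then have "g x - \<alpha> < g x + \<Phi> x (y - x) - \<Phi> y (y - x)"
        using \<Phi>b[of x "y - x"] \<Phi>b[of y "y - x"] d(2) by (simp add: abs_le_iff)
      also have "\<dots> \<le> g y - \<Phi> y (y - x)" using tangent[of x y] by simp
      also have "\<dots> = \<Phi> y x - (\<Phi> y y - g y)" by (simp add: blinfun.diff_right)
      finally show "g x - \<alpha> < \<Phi> y x - (\<Phi> y y - g y)" .
    qed
    then show ?thesis using d(1) by blast
  qed
  have "(g has_derivative blinfun_apply (\<Phi> x)) (at x)" for x
    unfolding has_derivative_at_alt
  proof (intro conjI allI impI)
    show "bounded_linear (blinfun_apply (\<Phi> x))" by (rule blinfun.bounded_linear_right)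
    fix e :: real assume "0 < e"
    from cont[OF this, of x] obtain d where
      d: "0 < d" "\<And>y. norm (y - x) < d \<Longrightarrow> norm (\<Phi> y - \<Phi> x) < e" by blast
    have "norm (g y - g x - \<Phi> x (y - x)) \<le> e * norm (y - x)" if y: "norm (y - x) < d" for y
    proof -
      have "g y - g x - \<Phi> x (y - x) \<le> (\<Phi> y - \<Phi> x) (y - x)"
        using tangent[of y x] by (simp add: blinfun.bilinear_simps)
      also have "\<dots> \<le> norm (\<Phi> y - \<Phi> x) * norm (y - x)"
        using norm_blinfun[of "\<Phi> y - \<Phi> x" "y - x"] by simp
      also have "\<dots> \<le> e * norm (y - x)"
        using d(2)[OF y] by (intro mult_right_mono) auto
      finally show ?thesis using tangent[of x y] by simp
    qed
    then show "\<exists>d>0. \<forall>y. norm (y - x) < d \<longrightarrow> norm (g y - g x - \<Phi> x (y - x)) \<le> e * norm (y - x)"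
      using d(1) by blast
  qed
  moreover have "continuous_on UNIV \<Phi>"
    unfolding continuous_on_iff using cont by (simp add: dist_norm)
  ultimately show ?thesis unfolding C1_on_def by auto
qed

text \<open>
  The approximation is the supremum of the affine minorants of \<open>f\<close>, each lowered by the penalty
  \<open>e * \<theta> \<phi>\<close>. It is a Legendre transform: \<open>B\<close> is the part over the ball of radius \<open>L\<close> of the epigraph of
  the conjugate of \<open>f\<close> plus \<open>e * \<theta>\<close>.
\<close>

theorem ex_C1_convex_approximation_of_lipschitz:
  fixes f :: "'a::real_normed_vector \<Rightarrow> real"
  assumes sepX: "separable_space (euclidean :: 'a topology)"
    and sepD: "separable_space (euclidean :: ('a \<Rightarrow>\<^sub>L real) topology)"
    and conv: "convex_on UNIV f" and lip: "L-lipschitz_on UNIV f" and e: "0 < e"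
  shows "\<exists>g. convex_on UNIV g \<and> C1_on UNIV g \<and> (\<forall>x. f x - e \<le> g x \<and> g x \<le> f x)"
proof -
  have L: "0 \<le> L" by (rule lipschitz_on_nonneg[OF lip])
  obtain \<theta> :: "('a \<Rightarrow>\<^sub>L real) \<Rightarrow> real" where
    \<theta>0: "\<And>\<phi>. \<phi> \<in> cball 0 L \<Longrightarrow> 0 \<le> \<theta> \<phi>" and \<theta>1: "\<And>\<phi>. \<phi> \<in> cball 0 L \<Longrightarrow> \<theta> \<phi> \<le> 1"
    and lsc: "weak_star_lsc_on (cball 0 L) \<theta>" and rotund: "strongly_rotund_on (cball 0 L) \<theta>"
    using ex_rotund_penalty[OF sepX sepD L] by blast
  define B :: "(('a \<Rightarrow>\<^sub>L real) \<times> real) set"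
    where "B = {(\<phi>, c). norm \<phi> \<le> L \<and> (\<forall>y. blinfun_apply \<phi> y + e * \<theta> \<phi> \<le> f y + c)}"
  define g where "g x = (SUP p\<in>B. blinfun_apply (fst p) x - snd p)" for x
  have Bf: "blinfun_apply \<phi> x - c \<le> f x" if "(\<phi>, c) \<in> B" for \<phi> c x
  proof -
    have "0 \<le> e * \<theta> \<phi>" using that e \<theta>0 by (auto simp: B_def)
    then show ?thesis using that by (auto simp: B_def dest!: spec[of _ x])
  qed
  have bdd: "bdd_above ((\<lambda>p. blinfun_apply (fst p) x - snd p) ` B)" for x
    using Bf by (intro bdd_aboveI2[of _ _ "f x"]) auto
  have minorant: "\<exists>\<phi> c. (\<phi>, c) \<in> B \<and> f x - e \<le> blinfun_apply \<phi> x - c" for x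
  proof -
    obtain \<phi> :: "'a \<Rightarrow>\<^sub>L real" where \<phi>: "norm \<phi> \<le> L" "\<And>y. f x + \<phi> (y - x) \<le> f y"
      using ex_subgradient_of_lipschitz_convex[OF conv lip] by blast
    have "e * \<theta> \<phi> \<le> e" using \<theta>1[of \<phi>] \<phi>(1) e by simp
    moreover have "(\<phi>, \<phi> x - f x + e * \<theta> \<phi>) \<in> B"
      using \<phi> by (auto simp: B_def blinfun.diff_right algebra_simps)
    ultimately show ?thesis by (intro exI[of _ \<phi>] exI[of _ "\<phi> x - f x + e * \<theta> \<phi>"]) auto
  qed
  then have Bne: "B \<noteq> {}" by blast
  have upper: "blinfun_apply \<phi> x - c \<le> g x" if "(\<phi>, c) \<in> B" for \<phi> c x
    unfolding g_def using cSUP_upper[OF that bdd, of x] by simp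
  have gle: "g x \<le> f x" for x
    unfolding g_def using Bf by (intro cSUP_least[OF Bne]) auto
  have gge: "f x - e \<le> g x" for x
    using minorant[of x] upper order_trans by blast
  have gconv: "convex_on UNIV g"
  proof (rule convex_onI)
    fix t :: real and x y assume t: "0 < t" "t < 1"
    show "g ((1 - t) *\<^sub>R x + t *\<^sub>R y) \<le> (1 - t) * g x + t * g y"
      unfolding g_def[of "(1 - t) *\<^sub>R x + t *\<^sub>R y"]
    proof (rule cSUP_least[OF Bne])
      fix p assume p: "p \<in> B"
      have "blinfun_apply (fst p) ((1 - t) *\<^sub>R x + t *\<^sub>R y) - snd p
          = (1 - t) * (blinfun_apply (fst p) x - snd p) + t * (blinfun_apply (fst p) y - snd p)"
        by (simp add: blinfun.bilinear_simps algebra_simps)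
      also have "\<dots> \<le> (1 - t) * g x + t * g y"
        using upper[of "fst p" "snd p"] p t by (intro add_mono mult_left_mono) auto
      finally show "blinfun_apply (fst p) ((1 - t) *\<^sub>R x + t *\<^sub>R y) - snd p \<le> (1 - t) * g x + t * g y" .
    qed
  qed simp
  \<comment> \<open>The midpoint of two elements of \<open>B\<close> remains in \<open>B\<close> after its constant is lowered by \<open>e\<close> times the gap; since
    its value at \<open>x\<close> is at most \<open>g x\<close>, two nearly optimal elements have a small gap.\<close>
  have gap: "e * midpoint_gap \<theta> \<phi> \<psi> \<le> (a + b) / 2"
    if "(\<phi>, c) \<in> B" "(\<psi>, d) \<in> B" "g x - a \<le> blinfun_apply \<phi> x - c" "g x - b \<le> blinfun_apply \<psi> x - d" for \<phi> \<psi> c d a b x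
  proof -
    let ?m = "(1/2) *\<^sub>R (\<phi> + \<psi>)" and ?c = "(c + d) / 2 - e * midpoint_gap \<theta> \<phi> \<psi>"
    have "(?m, ?c) \<in> B"
      unfolding B_def
    proof (intro CollectI case_prodI conjI allI)
      show "norm ?m \<le> L"
        using that(1,2) norm_triangle_ineq[of \<phi> \<psi>] by (auto simp: B_def)
      fix y
      have "\<phi> y + e * \<theta> \<phi> \<le> f y + c" "\<psi> y + e * \<theta> \<psi> \<le> f y + d"
        using that(1,2) by (auto simp: B_def)
      then show "?m y + e * \<theta> ?m \<le> f y + ?c"
        by (simp add: midpoint_gap_def blinfun.bilinear_simps algebra_simps add_divide_distrib)
    qed
    from upper[OF this, of x] show ?thesis
      using that(3,4) by (simp add: blinfun.bilinear_simps field_simps)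
  qed
  have attained: "\<exists>\<phi>. (\<phi>, blinfun_apply \<phi> x - g x) \<in> B" for x
  proof -
    have "\<exists>p\<in>B. g x - inverse (real (Suc k)) < blinfun_apply (fst p) x - snd p" for k
      using less_cSUP_iff[OF Bne bdd[of x], of "g x - inverse (real (Suc k))"] 
      by (simp add: g_def[symmetric])
    then obtain P where P: "\<And>k. P k \<in> B" "\<And>k. g x - inverse (real (Suc k)) < blinfun_apply (fst (P k)) x - snd (P k)"
      by metis
    define F where "F k = fst (P k)" for k
    define c where "c k = snd (P k)" for k
    have FB: "(F k, c k) \<in> B" for k using P by (simp add: F_def c_def)
    have Fg: "g x - inverse (real (Suc k)) \<le> F k x - c k" for k
      using P(2)[of k] by (simp add: F_def c_def)
    have FL: "norm (F k) \<le> L" for k using FB[of k] by (simp add: B_def)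
    have "\<exists>N. \<forall>k\<ge>N. \<forall>l\<ge>N. midpoint_gap \<theta> (F k) (F l) < \<eta>" if \<eta>: "0 < \<eta>" for \<eta>
    proof -
      obtain N where N: "inverse (real (Suc N)) < e * \<eta>"
        using reals_Archimedean[of "e * \<eta>"] e \<eta> by auto
      have "midpoint_gap \<theta> (F k) (F l) < \<eta>" if kl: "N \<le> k" "N \<le> l" for k l
      proof -
        have "e * midpoint_gap \<theta> (F k) (F l) \<le> (inverse (real (Suc k)) + inverse (real (Suc l))) / 2"
          by (rule gap[OF FB FB Fg Fg])
        also have "\<dots> \<le> inverse (real (Suc N))"
        proof -
          have "inverse (real (Suc j)) \<le> inverse (real (Suc N))" if "N \<le> j" for j
            using that by (intro le_imp_inverse_le) auto
          from add_mono[OF this[OF kl(1)] this[OF kl(2)]] show ?thesis by simp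
        qed
        also note N
        finally show ?thesis using e by simp
      qed
      then show ?thesis by blast
    qed
    then obtain \<phi> where \<phi>: "norm \<phi> \<le> L" "\<And>y. (\<lambda>k. F k y) \<longlonglongrightarrow> blinfun_apply \<phi> y"
      using rotund[unfolded strongly_rotund_on_def, THEN conjunct1, rule_format, of F] FL
      by (auto simp: image_subset_iff)
    \<comment> \<open>The limit functional is optimal: lower semicontinuity of \<open>\<theta>\<close> allows passing to the limit in the
      inequalities that express membership in \<open>B\<close>.\<close>
    have "\<phi> y + e * \<theta> \<phi> \<le> f y + (\<phi> x - g x)" for y
    proof (rule field_le_epsilon)
      fix \<eta> :: real assume \<eta>: "0 < \<eta>"
      have "\<forall>\<^sub>F k in sequentially. \<theta> \<phi> - \<eta> / e < \<theta> (F k)"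
        using FL \<phi> \<eta> e by (intro weak_star_lsc_onD[OF lsc]) auto
      then have ev: "\<forall>\<^sub>F k in sequentially.
          F k y + e * (\<theta> \<phi> - \<eta> / e) \<le> f y + (F k x - g x + inverse (real (Suc k)))"
      proof eventually_elim
        case (elim k)
        have "F k y + e * (\<theta> \<phi> - \<eta> / e) \<le> F k y + e * \<theta> (F k)"
          using elim e by simp
        also have "\<dots> \<le> f y + c k" using FB[of k] by (simp add: B_def)
        also have "\<dots> \<le> f y + (F k x - g x + inverse (real (Suc k)))" using Fg[of k] by simp
        finally show ?case .
      qed
      have "(\<lambda>k. F k y + e * (\<theta> \<phi> - \<eta> / e)) \<longlonglongrightarrow> \<phi> y + e * (\<theta> \<phi> - \<eta> / e)"
        by (intro tendsto_add tendsto_const \<phi>(2))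
      moreover have "(\<lambda>k. f y + (F k x - g x + inverse (real (Suc k)))) \<longlonglongrightarrow> f y + (\<phi> x - g x + 0)"
        by (intro tendsto_add tendsto_diff tendsto_const \<phi>(2) LIMSEQ_inverse_real_of_nat)
      ultimately have "\<phi> y + e * (\<theta> \<phi> - \<eta> / e) \<le> f y + (\<phi> x - g x + 0)"
        using tendsto_le[OF sequentially_bot _ _ ev] by blast
      then show "\<phi> y + e * \<theta> \<phi> \<le> f y + (\<phi> x - g x) + \<eta>"
        using e by (simp add: right_diff_distrib)
    qed
    then show ?thesis using \<phi>(1) by (auto simp: B_def)
  qed
  then obtain \<Phi> where \<Phi>: "\<And>x. (\<Phi> x, blinfun_apply (\<Phi> x) x - g x) \<in> B" by metis
  have "C1_on UNIV g"
  proof (rule C1_on_strongly_attained_supremum[where B = B and \<Phi> = \<Phi> and L = L, OF _ upper \<Phi>])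
    show "norm \<phi> \<le> L" if "(\<phi>, c) \<in> B" for \<phi> c using that by (simp add: B_def)
    fix x and \<epsilon> :: real assume \<epsilon>: "0 < \<epsilon>"
    have \<Phi>L: "norm (\<Phi> x) \<le> L" using \<Phi>[of x] by (simp add: B_def)
    obtain \<alpha> where \<alpha>: "0 < \<alpha>"
      "\<And>\<psi>. norm \<psi> \<le> L \<Longrightarrow> midpoint_gap \<theta> (\<Phi> x) \<psi> < \<alpha> \<Longrightarrow> norm (\<psi> - \<Phi> x) < \<epsilon>"
      using rotund[unfolded strongly_rotund_on_def, THEN conjunct2, rule_format, of "\<Phi> x" \<epsilon>] \<Phi>L \<epsilon>
      by auto
    have "norm (\<phi> - \<Phi> x) < \<epsilon>" if \<phi>: "(\<phi>, c) \<in> B" "g x - e * \<alpha> < blinfun_apply \<phi> x - c" for \<phi> c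
    proof (rule \<alpha>(2))
      show "norm \<phi> \<le> L" using \<phi> by (simp add: B_def)
      have "e * midpoint_gap \<theta> (\<Phi> x) \<phi> \<le> (0 + e * \<alpha>) / 2"
        by (rule gap[OF \<Phi>[of x] \<phi>(1), of x]) (use \<phi>(2) in auto)
      also have "\<dots> < e * \<alpha>" using e \<alpha>(1) by simp
      finally show "midpoint_gap \<theta> (\<Phi> x) \<phi> < \<alpha>" using e by simp
    qed
    then show "\<exists>\<alpha>>0. \<forall>\<phi> c. (\<phi>, c) \<in> B \<longrightarrow> g x - \<alpha> < blinfun_apply \<phi> x - c \<longrightarrow> norm (\<phi> - \<Phi> x) < \<epsilon>"
      using e \<alpha>(1) by (intro exI[of _ "e * \<alpha>"]) auto
  qed
  then show ?thesis using gconv gge gle by blast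
qed

section \<open>Gluing by smooth maxima\<close>

text \<open>
  A \<open>C\<^sup>1\<close> convex substitute for the positive part. It is the primitive of the function that vanishes up
  to \<open>- \<delta>\<close>, equals \<open>1\<close> from \<open>0\<close> on, and is affine in between. Writing it as a difference of squared
  positive parts avoids a definition by cases. It vanishes identically, rather than merely being
  small, for \<open>t \<le> - \<delta>\<close>; the gluing depends on this.
\<close>

definition soft_pos :: "real \<Rightarrow> real \<Rightarrow> real" where
  "soft_pos \<delta> t = ((max 0 (t + \<delta>))\<^sup>2 - (max 0 t)\<^sup>2) / (2 * \<delta>)"

lemma DERIV_max_0_power2: "((\<lambda>t::real. (max 0 t)\<^sup>2) has_real_derivative 2 * max 0 t) (at t)"
  unfolding has_field_derivative_def has_derivative_at_alt
proof (intro conjI allI impI)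
  fix e :: real assume e: "0 < e"
  have *: "\<bar>(max 0 s)\<^sup>2 - (max 0 t)\<^sup>2 - 2 * max 0 t * (s - t)\<bar> \<le> (s - t)\<^sup>2" for s
  proof -
    have "(max 0 s)\<^sup>2 - (max 0 t)\<^sup>2 - 2 * max 0 t * (s - t)
        = (max 0 s - max 0 t)\<^sup>2 + 2 * max 0 t * (max 0 s - s + (t - max 0 t))"
      by (simp add: power2_eq_square algebra_simps)
    also have "2 * max 0 t * (max 0 s - s + (t - max 0 t)) = 2 * max 0 t * max 0 (- s)"
      by (auto simp: max_def)
    finally have eq: "(max 0 s)\<^sup>2 - (max 0 t)\<^sup>2 - 2 * max 0 t * (s - t)
        = (max 0 s - max 0 t)\<^sup>2 + 2 * max 0 t * max 0 (- s)" .
    have "(max 0 s - max 0 t)\<^sup>2 + 2 * max 0 t * max 0 (- s) \<le> (s - t)\<^sup>2"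
    proof (cases "s \<le> 0")
      case True
      show ?thesis
      proof (cases "t \<le> 0")
        case True
        then show ?thesis using \<open>s \<le> 0\<close> by (simp add: max_absorb1)
      next
        case False
        then show ?thesis using \<open>s \<le> 0\<close>
          by (simp add: max_absorb1 max_absorb2 power2_eq_square algebra_simps)
      qed
    next
      case False
      have "\<bar>max 0 s - max 0 t\<bar> \<le> \<bar>s - t\<bar>" by (auto simp: max_def)
      then have "(max 0 s - max 0 t)\<^sup>2 \<le> (s - t)\<^sup>2" by (simp only: abs_le_square_iff)
      then show ?thesis using False by (simp add: max_def)
    qed
    then show ?thesis unfolding eq by (simp add: max_def)
  qed
  have "norm ((max 0 s)\<^sup>2 - (max 0 t)\<^sup>2 - 2 * max 0 t * (s - t)) \<le> e * norm (s - t)"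
    if "norm (s - t) < e" for s
  proof -
    have "(s - t)\<^sup>2 = \<bar>s - t\<bar> * \<bar>s - t\<bar>" by (simp add: power2_eq_square flip: abs_mult)
    also have "\<dots> \<le> e * \<bar>s - t\<bar>" using that by (intro mult_right_mono) auto
    finally show ?thesis using *[of s] by simp
  qed
  then show "\<exists>d>0. \<forall>y. norm (y - t) < d \<longrightarrow>
      norm ((max 0 y)\<^sup>2 - (max 0 t)\<^sup>2 - 2 * max 0 t * (y - t)) \<le> e * norm (y - t)"
    using e by blast
qed (rule bounded_linear_mult_right)

lemma DERIV_soft_pos:
  assumes "0 < \<delta>"
  shows "(soft_pos \<delta> has_real_derivative (max 0 (t + \<delta>) - max 0 t) / \<delta>) (at t)"
proof -
  have "((\<lambda>t. (max 0 (t + \<delta>))\<^sup>2) has_real_derivative 2 * max 0 (t + \<delta>)) (at t)"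
    using DERIV_max_0_power2[of "t + \<delta>"] by (simp add: DERIV_shift)
  from DERIV_cdivide[OF DERIV_diff[OF this DERIV_max_0_power2], of "2 * \<delta>"]
  show ?thesis
    unfolding soft_pos_def[abs_def] by (rule DERIV_cong) (use assms in \<open>simp add: field_simps\<close>)
qed

lemma soft_pos_mono:
  assumes "0 < \<delta>" "s \<le> t"
  shows "soft_pos \<delta> s \<le> soft_pos \<delta> t"
proof (rule DERIV_nonneg_imp_nondecreasing[OF assms(2)])
  show "\<exists>y. (soft_pos \<delta> has_real_derivative y) (at x) \<and> 0 \<le> y" for x
    using DERIV_soft_pos[OF assms(1)] assms(1) by (intro exI conjI) (auto simp: max_def)
qed

lemma soft_pos_nonexpansive:
  assumes "0 < \<delta>" "s \<le> t"
  shows "soft_pos \<delta> t \<le> soft_pos \<delta> s + (t - s)"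
proof -
  have "s - soft_pos \<delta> s \<le> t - soft_pos \<delta> t"
  proof (rule DERIV_nonneg_imp_nondecreasing[OF assms(2)])
    fix x
    have "((\<lambda>x. x - soft_pos \<delta> x) has_real_derivative 1 - (max 0 (x + \<delta>) - max 0 x) / \<delta>) (at x)"
      by (intro DERIV_diff DERIV_ident DERIV_soft_pos assms(1))
    moreover have "(max 0 (x + \<delta>) - max 0 x) / \<delta> \<le> 1"
      using assms(1) by (auto simp: max_def field_simps)
    ultimately show "\<exists>y. ((\<lambda>x. x - soft_pos \<delta> x) has_real_derivative y) (at x) \<and> 0 \<le> y"
      by (intro exI conjI) auto
  qed
  then show ?thesis by simp
qed

lemma convex_on_soft_pos:
  assumes "0 < \<delta>"
  shows "convex_on UNIV (soft_pos \<delta>)"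
proof (rule convex_on_realI)
  show "(max 0 (s + \<delta>) - max 0 s) / \<delta> \<le> (max 0 (t + \<delta>) - max 0 t) / \<delta>" if "s \<le> t" for s t
    using assms that by (intro divide_right_mono) (auto simp: max_def)
qed (auto intro: DERIV_soft_pos[OF assms])

lemma soft_pos_eq_0: "t \<le> - \<delta> \<Longrightarrow> 0 < \<delta> \<Longrightarrow> soft_pos \<delta> t = 0"
  by (simp add: soft_pos_def max_def)

lemma soft_pos_nonneg: "0 < \<delta> \<Longrightarrow> 0 \<le> soft_pos \<delta> t"
  by (auto simp: soft_pos_def intro!: divide_nonneg_pos power_mono)

lemma soft_pos_of_nonneg: "0 \<le> t \<Longrightarrow> 0 < \<delta> \<Longrightarrow> soft_pos \<delta> t = t + \<delta> / 2"
  by (simp add: soft_pos_def max_def power2_eq_square field_simps)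

lemma soft_pos_ge: "0 < \<delta> \<Longrightarrow> t \<le> soft_pos \<delta> t"
  using soft_pos_nonneg[of \<delta> t] soft_pos_of_nonneg[of t \<delta>] by (cases "0 \<le> t") auto

lemma soft_pos_le: "0 < \<delta> \<Longrightarrow> soft_pos \<delta> t \<le> max 0 t + \<delta>"
  using soft_pos_mono[of \<delta> t "max 0 t"] soft_pos_of_nonneg[of "max 0 t" \<delta>] by simp

definition soft_max :: "real \<Rightarrow> real \<Rightarrow> real \<Rightarrow> real" where
  "soft_max \<delta> a b = a + soft_pos \<delta> (b - a)"

lemma soft_max_mono:
  assumes "0 < \<delta>" "a \<le> a'" "b \<le> b'"
  shows "soft_max \<delta> a b \<le> soft_max \<delta> a' b'"
  using soft_pos_mono[OF assms(1), of "b - a" "b' - a"] 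
    soft_pos_nonexpansive[OF assms(1), of "b' - a'" "b' - a"] assms(2,3)
  by (simp add: soft_max_def)

text \<open>
  A convex function of \<open>(a, b)\<close> composed with convex functions \<open>a\<close> and \<open>b\<close> is convex because it is
  nondecreasing in both arguments; for \<open>a\<close>, this is where the slope of \<open>soft_pos\<close> must not exceed \<open>1\<close>.
\<close>

lemma convex_on_soft_max:
  assumes "0 < \<delta>" "convex_on U a" "convex_on U b"
  shows "convex_on U (\<lambda>x. soft_max \<delta> (a x) (b x))"
proof (rule convex_onI)
  fix t :: real and x y assume t: "0 < t" "t < 1" and xy: "x \<in> U" "y \<in> U"
  let ?z = "(1 - t) *\<^sub>R x + t *\<^sub>R y"
  have "soft_max \<delta> (a ?z) (b ?z) \<le> soft_max \<delta> ((1 - t) * a x + t * a y) ((1 - t) * b x + t * b y)"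
    using t xy by (intro soft_max_mono assms(1) convex_onD[OF assms(2)] convex_onD[OF assms(3)]) auto
  also have "\<dots> \<le> (1 - t) * soft_max \<delta> (a x) (b x) + t * soft_max \<delta> (a y) (b y)"
    using convex_onD[OF convex_on_soft_pos[OF assms(1)], of t "b x - a x" "b y - a y"] t
    by (simp add: soft_max_def algebra_simps)
  finally show "soft_max \<delta> (a ?z) (b ?z) \<le> (1 - t) * soft_max \<delta> (a x) (b x) + t * soft_max \<delta> (a y) (b y)" .
qed (rule convex_on_imp_convex[OF assms(2)])

lemma C1_on_soft_max:
  fixes a b :: "'a::real_normed_vector \<Rightarrow> real"
  assumes \<delta>: "0 < \<delta>" and "C1_on U a" "C1_on U b"
  shows "C1_on U (\<lambda>x. soft_max \<delta> (a x) (b x))"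
proof -
  obtain A where A: "\<And>x. x \<in> U \<Longrightarrow> (a has_derivative blinfun_apply (A x)) (at x)" "continuous_on U A"
    using assms(2) by (auto simp: C1_on_def)
  obtain B where B: "\<And>x. x \<in> U \<Longrightarrow> (b has_derivative blinfun_apply (B x)) (at x)" "continuous_on U B"
    using assms(3) by (auto simp: C1_on_def)
  define w where "w x = (max 0 (b x - a x + \<delta>) - max 0 (b x - a x)) / \<delta>" for x
  have ca: "continuous_on U a" and cb: "continuous_on U b"
    using A(1) B(1) by (meson has_derivative_continuous continuous_at_imp_continuous_on)+
  have "((\<lambda>x. soft_max \<delta> (a x) (b x)) has_derivative blinfun_apply (A x + w x *\<^sub>R (B x - A x))) (at x)"
    if x: "x \<in> U" for x
  proof -
    have "((\<lambda>x. soft_pos \<delta> (b x - a x)) has_derivative (\<lambda>v. w x * (B x v - A x v))) (at x)"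
      using has_derivative_compose[OF has_derivative_diff[OF B(1)[OF x] A(1)[OF x]]
        DERIV_soft_pos[OF \<delta>, of "b x - a x", unfolded has_field_derivative_def]]
      by (simp add: w_def)
    moreover have "blinfun_apply (A x + w x *\<^sub>R (B x - A x)) = (\<lambda>v. A x v + w x * (B x v - A x v))"
      by (simp add: fun_eq_iff blinfun.bilinear_simps)
    ultimately show ?thesis
      unfolding soft_max_def using has_derivative_add[OF A(1)[OF x]] by simp
  qed
  moreover have "continuous_on U (\<lambda>x. A x + w x *\<^sub>R (B x - A x))"
    unfolding w_def using \<delta> by (intro continuous_intros A B ca cb) auto
  ultimately show ?thesis
    unfolding C1_on_def by (intro exI[of _ "\<lambda>x. A x + w x *\<^sub>R (B x - A x)"]) simp
qed

lemma C1_on_subset: "C1_on V g \<Longrightarrow> U \<subseteq> V \<Longrightarrow> C1_on U g"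
  unfolding C1_on_def by (meson continuous_on_subset subsetD)

text \<open>
  Derivatives at points of an open set are unique, so the local derivatives fit together.
\<close>

lemma C1_on_locally:
  assumes "\<And>x. x \<in> U \<Longrightarrow> \<exists>V h. open V \<and> x \<in> V \<and> C1_on V h \<and> (\<forall>y\<in>V. g y = h y)"
  shows "C1_on U g"
proof -
  define D where "D x = (SOME d. (g has_derivative blinfun_apply d) (at x))" for x
  have "\<exists>V. open V \<and> x \<in> V \<and> (\<forall>y\<in>V. (g has_derivative blinfun_apply (D y)) (at y)) \<and> continuous_on V D"
    if x: "x \<in> U" for x
  proof -
    obtain V h where V: "open V" "x \<in> V" "C1_on V h" "\<And>y. y \<in> V \<Longrightarrow> g y = h y"
      using assms[OF x] by auto
    obtain E where E: "\<And>y. y \<in> V \<Longrightarrow> (h has_derivative blinfun_apply (E y)) (at y)" "continuous_on V E"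
      using V(3) by (auto simp: C1_on_def)
    have gE: "(g has_derivative blinfun_apply (E y)) (at y)" if "y \<in> V" for y
      using has_derivative_transform_within_open[OF E(1)[OF that] V(1) that] V(4) by simp
    have DE: "D y = E y" if "y \<in> V" for y
    proof -
      have "(g has_derivative blinfun_apply (D y)) (at y)"
        unfolding D_def by (rule someI[of "\<lambda>d. (g has_derivative blinfun_apply d) (at y)", OF gE[OF that]])
      then have "blinfun_apply (D y) = blinfun_apply (E y)"
        by (rule has_derivative_unique[OF _ gE[OF that]])
      then show ?thesis by (simp add: blinfun_apply_inject)
    qed
    have "continuous_on V D" using E(2) DE by (simp cong: continuous_on_cong)
    then show ?thesis using V(1,2) gE DE by auto
  qed
  then have "(g has_derivative blinfun_apply (D x)) (at x) \<and> isCont D x" if "x \<in> U" for x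
    using that continuous_on_eq_continuous_at by blast
  then have "\<forall>x\<in>U. (g has_derivative blinfun_apply (D x)) (at x)" "continuous_on U D"
    by (auto intro: continuous_at_imp_continuous_on)
  then show ?thesis unfolding C1_on_def by blast
qed

text \<open>
  Near \<open>x0\<close> the function varies by less than \<open>2\<close>. Prolonging the segment from \<open>y\<close> to \<open>x\<close> beyond \<open>x\<close> by the
  length \<open>r\<close> leads to a point \<open>z\<close> where \<open>f z < f x + 2\<close>, and convexity on the segment from \<open>z\<close> to \<open>y\<close> turns
  this into a lower bound for \<open>f y\<close>. The bound holds for all \<open>y\<close> in \<open>U\<close>, however far away.
\<close>

lemma convex_on_imp_locally_uniform_slope:
  fixes f :: "'a::real_normed_vector \<Rightarrow> real"
  assumes U: "open U" and cont: "continuous_on U f" and conv: "convex_on U f" and x0: "x0 \<in> U"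
  shows "\<exists>r>0. \<exists>k. ball x0 r \<subseteq> U \<and> (\<forall>x\<in>ball x0 r. \<forall>y\<in>U. f x - k * norm (x - y) \<le> f y)"
proof -
  obtain r1 where r1: "0 < r1" "ball x0 r1 \<subseteq> U" using U x0 open_contains_ball by blast
  obtain r2 where r2: "0 < r2" "\<And>x. x \<in> U \<Longrightarrow> dist x x0 < r2 \<Longrightarrow> dist (f x) (f x0) < 1"
    using cont x0 unfolding continuous_on_iff by (metis zero_less_one)
  define r where "r = min r1 r2 / 3"
  have r: "0 < r" "3 * r \<le> r1" "3 * r \<le> r2" using r1 r2 by (auto simp: r_def)
  have near: "z \<in> U \<and> \<bar>f z - f x0\<bar> < 1" if "dist x0 z < 3 * r" for z
  proof -
    have "z \<in> U" using that r r1(2) by (auto simp: subset_iff)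
    then show ?thesis using that r r2(2)[of z] by (simp add: dist_commute[of x0] dist_real_def)
  qed
  show ?thesis
  proof (rule exI[of _ r], rule conjI[OF r(1)], rule exI[of _ "2 / r"], intro conjI ballI)
    show "ball x0 r \<subseteq> U" using near r by auto
    fix x y assume x: "x \<in> ball x0 r" and y: "y \<in> U"
    show "f x - 2 / r * norm (x - y) \<le> f y"
    proof (cases "x = y")
      case False
      define d where "d = norm (x - y)"
      have d: "0 < d" using False by (simp add: d_def)
      define z where "z = x + (r / d) *\<^sub>R (x - y)"
      have "dist x0 z \<le> dist x0 x + norm (z - x)"
        using dist_triangle[of x0 z x] by (simp add: dist_norm norm_minus_commute)
      also have "norm (z - x) = r" using d r by (simp add: z_def d_def)
      finally have z: "z \<in> U" "\<bar>f z - f x0\<bar> < 1" using near[of z] x r by auto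
      have fx: "\<bar>f x - f x0\<bar> < 1" using near[of x] x r by auto
      have t1: "1 - r / (r + d) = d / (r + d)" using d r by (simp add: field_simps)
      have "(1 - r / (r + d)) *\<^sub>R z + (r / (r + d)) *\<^sub>R y
          = (d / (r + d) + d / (r + d) * (r / d)) *\<^sub>R x + (r / (r + d) - d / (r + d) * (r / d)) *\<^sub>R y"
        unfolding t1 by (simp add: z_def algebra_simps)
      also have "d / (r + d) * (r / d) = r / (r + d)" using d by simp
      also have "d / (r + d) + r / (r + d) = 1" using d r by (simp flip: add_divide_distrib)
      finally have "(1 - r / (r + d)) *\<^sub>R z + (r / (r + d)) *\<^sub>R y = x" by simp
      then have "f x \<le> d / (r + d) * f z + r / (r + d) * f y"
        using convex_onD[OF conv, of "r / (r + d)" z y] z y d r unfolding t1 by simp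
      then have "f x \<le> (d * f z + r * f y) / (r + d)" by (simp add: add_divide_distrib)
      then have "(r + d) * f x \<le> d * f z + r * f y"
        using d r by (simp add: pos_le_divide_eq mult.commute)
      moreover have "d * f z \<le> d * (f x + 2)" using z fx d by (intro mult_left_mono) auto
      ultimately have "r * f x \<le> r * f y + 2 * d" by (simp add: algebra_simps)
      then show ?thesis using r unfolding d_def[symmetric] by (simp add: field_simps)
    qed simp
  qed
qed

text \<open>
  The largest \<open>n\<close>-Lipschitz function on the whole space that is below \<open>f\<close> on \<open>U\<close>, provided that there is
  one.
\<close>

definition lipschitz_envelope :: "'a::real_normed_vector set \<Rightarrow> ('a \<Rightarrow> real) \<Rightarrow> real \<Rightarrow> 'a \<Rightarrow> real" where
  "lipschitz_envelope U f n x = (INF y\<in>U. f y + n * norm (x - y))"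

text \<open>
  The envelope is finite everywhere as soon as \<open>f\<close> has a global lower bound of slope \<open>n\<close> at one point, and
  it agrees with \<open>f\<close> at each such point.
\<close>

context
  fixes U :: "'a::real_normed_vector set" and f :: "'a \<Rightarrow> real" and x0 :: 'a and n :: real
  assumes x0: "x0 \<in> U" and slope: "\<And>y. y \<in> U \<Longrightarrow> f x0 - n * norm (x0 - y) \<le> f y" and n: "0 \<le> n"
begin

lemma bdd_below_lipschitz_envelope: "bdd_below ((\<lambda>y. f y + n * norm (x - y)) ` U)"
proof (rule bdd_belowI2)
  fix y assume "y \<in> U"
  have "n * norm (x0 - y) \<le> n * norm (x0 - x) + n * norm (x - y)"
    using n norm_triangle_ineq[of "x0 - x" "x - y"] by (simp add: mult_left_mono flip: distrib_left)
  then show "f x0 - n * norm (x0 - x) \<le> f y + n * norm (x - y)"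
    using slope[OF \<open>y \<in> U\<close>] by simp
qed

lemma lipschitz_envelope_le: "x \<in> U \<Longrightarrow> lipschitz_envelope U f n x \<le> f x"
  unfolding lipschitz_envelope_def using cINF_lower[OF bdd_below_lipschitz_envelope, of x x] by simp

lemma lipschitz_on_lipschitz_envelope: "n-lipschitz_on UNIV (lipschitz_envelope U f n)"
  unfolding lipschitz_envelope_def
proof (rule lipschitz_on_INF[OF _ _ bdd_below_lipschitz_envelope])
  fix y assume "y \<in> U"
  show "n-lipschitz_on UNIV (\<lambda>x. f y + n * norm (x - y))"
  proof (rule lipschitz_on_realI[OF n])
    fix x z
    show "f y + n * norm (x - y) \<le> f y + n * norm (z - y) + n * norm (x - z)"
      using n norm_triangle_ineq[of "z - y" "x - z"] by (simp add: mult_left_mono flip: distrib_left)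
  qed
qed (use x0 in auto)

lemma convex_on_lipschitz_envelope:
  assumes "convex_on U f"
  shows "convex_on UNIV (lipschitz_envelope U f n)"
  unfolding lipschitz_envelope_def
proof (rule convex_on_INF_marginal[OF _ _ bdd_below_lipschitz_envelope])
  show "convex_on (UNIV \<times> U) (\<lambda>(x, y). f y + n * norm (x - y))"
  proof (rule convex_onI)
    fix t :: real and p q :: "'a \<times> 'a" assume t: "0 < t" "t < 1"
      and p: "p \<in> UNIV \<times> U" and q: "q \<in> UNIV \<times> U"
    obtain x y where xy: "p = (x, y)" "y \<in> U" using p by auto
    obtain u v where uv: "q = (u, v)" "v \<in> U" using q by auto
    have "((1 - t) *\<^sub>R x + t *\<^sub>R u) - ((1 - t) *\<^sub>R y + t *\<^sub>R v) = (1 - t) *\<^sub>R (x - y) + t *\<^sub>R (u - v)"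
      by (simp add: algebra_simps)
    then have "norm (((1 - t) *\<^sub>R x + t *\<^sub>R u) - ((1 - t) *\<^sub>R y + t *\<^sub>R v))
        \<le> (1 - t) * norm (x - y) + t * norm (u - v)"
      using norm_triangle_ineq[of "(1 - t) *\<^sub>R (x - y)" "t *\<^sub>R (u - v)"] t by simp
    from mult_left_mono[OF this n] convex_onD[OF assms, of t y v] t xy uv
    show "(case (1 - t) *\<^sub>R p + t *\<^sub>R q of (x, y) \<Rightarrow> f y + n * norm (x - y))
        \<le> (1 - t) * (case p of (x, y) \<Rightarrow> f y + n * norm (x - y)) + t * (case q of (x, y) \<Rightarrow> f y + n * norm (x - y))"
      by (simp add: algebra_simps)
  qed (use convex_on_imp_convex[OF assms] in \<open>simp add: convex_Times\<close>)
qed (use x0 in auto)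

lemma lipschitz_envelope_eq: "lipschitz_envelope U f n x0 = f x0"
proof (rule antisym)
  show "f x0 \<le> lipschitz_envelope U f n x0"
    unfolding lipschitz_envelope_def using x0 slope by (intro cINF_greatest) (auto simp: algebra_simps)
qed (rule lipschitz_envelope_le[OF x0])

end

primrec soft_max_upto :: "(nat \<Rightarrow> real) \<Rightarrow> (nat \<Rightarrow> 'a \<Rightarrow> real) \<Rightarrow> nat \<Rightarrow> 'a \<Rightarrow> real" where
  "soft_max_upto \<delta> g 0 x = g 0 x"
| "soft_max_upto \<delta> g (Suc n) x = soft_max (\<delta> n) (soft_max_upto \<delta> g n x) (g (Suc n) x)"

lemma convex_on_soft_max_upto:
  assumes "\<And>n. 0 < \<delta> n" "\<And>n. convex_on U (g n)"
  shows "convex_on U (soft_max_upto \<delta> g n)"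
proof (induction n)
  case 0
  have "soft_max_upto \<delta> g 0 = g 0" by (simp add: fun_eq_iff)
  then show ?case using assms(2) by simp
next
  case (Suc n)
  have "soft_max_upto \<delta> g (Suc n) = (\<lambda>x. soft_max (\<delta> n) (soft_max_upto \<delta> g n x) (g (Suc n) x))"
    by (simp add: fun_eq_iff)
  then show ?case using convex_on_soft_max[OF assms(1) Suc assms(2)] by simp
qed

lemma C1_on_soft_max_upto:
  assumes "\<And>n. 0 < \<delta> n" "\<And>n. C1_on U (g n)"
  shows "C1_on U (soft_max_upto \<delta> g n)"
proof (induction n)
  case 0
  have "soft_max_upto \<delta> g 0 = g 0" by (simp add: fun_eq_iff)
  then show ?case using assms(2) by simp
next
  case (Suc n)
  have "soft_max_upto \<delta> g (Suc n) = (\<lambda>x. soft_max (\<delta> n) (soft_max_upto \<delta> g n x) (g (Suc n) x))"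
    by (simp add: fun_eq_iff)
  then show ?case using C1_on_soft_max[OF assms(1) Suc assms(2)] by simp
qed

lemma soft_max_upto_ge:
  assumes "\<And>n. 0 < \<delta> n"
  shows "g n x \<le> soft_max_upto \<delta> g n x"
proof (cases n)
  case (Suc m)
  then show ?thesis
    using soft_pos_ge[OF assms, of "g n x - soft_max_upto \<delta> g m x" m] by (simp add: soft_max_def)
qed simp

text \<open>
  Let \<open>F n\<close> be Lipschitz envelopes of \<open>f\<close> with constants increasing to infinity and \<open>\<sigma> n = \<epsilon> / 4 / 2 ^ n\<close>.
  The approximation \<open>g n\<close> is placed between \<open>F n - \<epsilon> + 2 * \<sigma> n\<close> and \<open>F n - \<epsilon> + 3 * \<sigma> n\<close>. Near a point
  where \<open>F n = f\<close> for \<open>n \<ge> K\<close>, every later \<open>g (n + 1)\<close> is at most \<open>f - \<epsilon> + 3 * \<sigma> (n + 1)\<close>, and this is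
  below \<open>g K \<ge> f - \<epsilon> + 2 * \<sigma> K\<close> by at least \<open>\<sigma> (n + 1)\<close>, because \<open>2 * \<sigma> (n + 1) \<le> \<sigma> K\<close>. A smooth maximum
  of width \<open>\<sigma> (n + 1)\<close> therefore does not change at step \<open>n + 1\<close>. The smooth maxima exceed the true ones,
  but the widths add up to \<open>\<sigma> 0\<close>, which together with the initial \<open>3 * \<sigma> 0\<close> is \<open>\<epsilon>\<close>; so the limit stays
  below \<open>f\<close>.
\<close>

theorem ex_C1_convex_approximation_if_lipschitz:
  fixes f :: "'a::real_normed_vector \<Rightarrow> real"
  assumes lip: "\<And>(F :: 'a \<Rightarrow> real) L e. convex_on UNIV F \<Longrightarrow> L-lipschitz_on UNIV F \<Longrightarrow> 0 < e \<Longrightarrow>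
      \<exists>g. convex_on UNIV g \<and> C1_on UNIV g \<and> (\<forall>x. F x - e \<le> g x \<and> g x \<le> F x)"
    and U: "open U" and cont: "continuous_on U f" and conv: "convex_on U f" and \<epsilon>: "0 < \<epsilon>"
  shows "\<exists>g. convex_on U g \<and> C1_on U g \<and> (\<forall>x\<in>U. f x - \<epsilon> \<le> g x \<and> g x \<le> f x)"
proof (cases "U = {}")
  case True
  then show ?thesis using conv by (auto simp: C1_on_def)
next
  case False
  then obtain a where a: "a \<in> U" by auto
  obtain r0 k0 where "0 < r0" and k0: "\<forall>x\<in>ball a r0. \<forall>y\<in>U. f x - k0 * norm (x - y) \<le> f y"
    using convex_on_imp_locally_uniform_slope[OF U cont conv a] by blast
  \<comment> \<open>Envelopes with constants below \<open>k0\<close> might be minus infinity; \<open>N\<close> excludes these.\<close>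
  define N where "N = nat \<lceil>k0\<rceil>"
  define F where "F n = lipschitz_envelope U f (real (N + n))" for n
  define \<sigma> where "\<sigma> n = \<epsilon> / 4 * (1/2) ^ n" for n
  have slope_mono: "f x - l * norm (x - y) \<le> f y" if "f x - k * norm (x - y) \<le> f y" "k \<le> l" for x y k l
    using that mult_right_mono[OF that(2) norm_ge_zero[of "x - y"]] by linarith
  have slope_a: "f a - real (N + n) * norm (a - y) \<le> f y" if "y \<in> U" for y n
  proof (rule slope_mono)
    show "f a - k0 * norm (a - y) \<le> f y" using k0 that \<open>0 < r0\<close> by simp
    show "k0 \<le> real (N + n)" unfolding N_def by linarith
  qed
  have Fconv: "convex_on UNIV (F n)" for n
    unfolding F_def by (rule convex_on_lipschitz_envelope[OF a slope_a _ conv]) auto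
  have Flip: "(real (N + n))-lipschitz_on UNIV (F n)" for n
    unfolding F_def by (rule lipschitz_on_lipschitz_envelope[OF a slope_a]) auto
  have Fle: "F n x \<le> f x" if "x \<in> U" for n x
    unfolding F_def by (rule lipschitz_envelope_le[OF a slope_a _ that]) auto
  have Feq: "\<exists>r>0. \<exists>K. ball x r \<subseteq> U \<and> (\<forall>y\<in>ball x r. \<forall>n\<ge>K. F n y = f y)" if x: "x \<in> U" for x
  proof -
    obtain r k where r: "0 < r" "ball x r \<subseteq> U"
      and k: "\<forall>y\<in>ball x r. \<forall>z\<in>U. f y - k * norm (y - z) \<le> f z"
      using convex_on_imp_locally_uniform_slope[OF U cont conv x] by blast
    have "F n y = f y" if y: "y \<in> ball x r" and n: "nat \<lceil>k\<rceil> \<le> n" for y n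
      unfolding F_def
    proof (rule lipschitz_envelope_eq)
      show "y \<in> U" using r y by auto
      fix z assume "z \<in> U"
      show "f y - real (N + n) * norm (y - z) \<le> f z"
        by (rule slope_mono[OF k[rule_format, OF y \<open>z \<in> U\<close>]]) (use n in linarith)
    qed simp
    then show ?thesis using r by blast
  qed
  have \<sigma>pos: "0 < \<sigma> n" for n using \<epsilon> by (simp add: \<sigma>_def)
  have \<sigma>Suc: "\<sigma> (Suc n) = \<sigma> n / 2" for n by (simp add: \<sigma>_def)
  have \<sigma>dec: "\<sigma> n \<le> \<sigma> m" if "m \<le> n" for m n
    using \<epsilon> that by (simp add: \<sigma>_def power_decreasing)
  have \<sigma>0: "4 * \<sigma> 0 = \<epsilon>" by (simp add: \<sigma>_def)
  have "\<exists>g. convex_on UNIV g \<and> C1_on UNIV g \<and>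
      (\<forall>x. F n x - \<epsilon> + 2 * \<sigma> n \<le> g x \<and> g x \<le> F n x - \<epsilon> + 3 * \<sigma> n)" for n
  proof -
    have "convex_on UNIV (\<lambda>x. F n x + (3 * \<sigma> n - \<epsilon>))"
      by (intro convex_on_add Fconv) (simp add: convex_on_const)
    moreover have "(real (N + n))-lipschitz_on UNIV (\<lambda>x. F n x + (3 * \<sigma> n - \<epsilon>))"
      using lipschitz_on_real_le[OF Flip[of n]] by (intro lipschitz_on_realI) auto
    ultimately obtain g where "convex_on UNIV g" "C1_on UNIV g"
      and "\<forall>x. F n x + (3 * \<sigma> n - \<epsilon>) - \<sigma> n \<le> g x \<and> g x \<le> F n x + (3 * \<sigma> n - \<epsilon>)"
      using lip[OF _ _ \<sigma>pos] by blast
    then show ?thesis by (intro exI[of _ g]) (simp add: algebra_simps)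
  qed
  then have "\<forall>n. \<exists>g. convex_on UNIV g \<and> C1_on UNIV g \<and>
      (\<forall>x. F n x - \<epsilon> + 2 * \<sigma> n \<le> g x \<and> g x \<le> F n x - \<epsilon> + 3 * \<sigma> n)" ..
  from choice[OF this] obtain g where g: "\<forall>n. convex_on UNIV (g n) \<and> C1_on UNIV (g n) \<and>
      (\<forall>x. F n x - \<epsilon> + 2 * \<sigma> n \<le> g n x \<and> g n x \<le> F n x - \<epsilon> + 3 * \<sigma> n)" ..
  have gconv: "convex_on UNIV (g n)" and gC1: "C1_on UNIV (g n)"
    and gge: "F n x - \<epsilon> + 2 * \<sigma> n \<le> g n x" and gle: "g n x \<le> F n x - \<epsilon> + 3 * \<sigma> n" for n x
    using g by auto
  define H where "H = soft_max_upto (\<lambda>n. \<sigma> (Suc n)) g"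
  define h where "h x = lim (\<lambda>n. H n x)" for x
  have HSuc: "H (Suc n) x = soft_max (\<sigma> (Suc n)) (H n x) (g (Suc n) x)" for n x by (simp add: H_def)
  have Hconv: "convex_on UNIV (H n)" for n
    unfolding H_def by (rule convex_on_soft_max_upto[OF \<sigma>pos gconv])
  have HC1: "C1_on UNIV (H n)" for n
    unfolding H_def by (rule C1_on_soft_max_upto[OF \<sigma>pos gC1])
  have Hge: "g n x \<le> H n x" for n x
    unfolding H_def by (rule soft_max_upto_ge[OF \<sigma>pos])
  have Hle: "H n x \<le> f x - \<sigma> n" if x: "x \<in> U" for n x
  proof (induction n)
    case 0
    show ?case using gle[of 0 x] Fle[OF x, of 0] \<sigma>0 by (simp add: H_def)
  next
    case (Suc n)
    have "g (Suc n) x \<le> f x - \<sigma> n"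
      using gle[of "Suc n" x] Fle[OF x, of "Suc n"] \<sigma>0 \<sigma>Suc[of n] \<sigma>dec[of 0 n] \<sigma>pos[of n] by simp
    then have "max 0 (g (Suc n) x - H n x) \<le> f x - \<sigma> n - H n x" using Suc by simp
    then have "H (Suc n) x \<le> f x - \<sigma> n + \<sigma> (Suc n)"
      using soft_pos_le[OF \<sigma>pos, of "Suc n" "g (Suc n) x - H n x"]
      unfolding HSuc soft_max_def by linarith
    then show ?case using \<sigma>Suc[of n] by simp
  qed
  have stable: "\<exists>r>0. \<exists>K. ball x r \<subseteq> U \<and>
      (\<forall>y\<in>ball x r. f y - \<epsilon> \<le> H K y \<and> (\<forall>n\<ge>K. H n y = H K y) \<and> h y = H K y)" if x: "x \<in> U" for x
  proof -
    obtain r K where r: "0 < r" "ball x r \<subseteq> U" and K: "\<forall>y\<in>ball x r. \<forall>n\<ge>K. F n y = f y"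
      using Feq[OF x] by blast
    have low: "f y - \<epsilon> + 2 * \<sigma> K \<le> H K y" if "y \<in> ball x r" for y
      using gge[of K y] Hge[of K y] K that by simp
    have const: "H n y = H K y" if y: "y \<in> ball x r" and n: "K \<le> n" for y n
      using n
    proof (induction n rule: dec_induct)
      case (step n)
      have "g (Suc n) y - H n y \<le> - \<sigma> (Suc n)"
        using low[OF y] gle[of "Suc n" y] K[rule_format, OF y, of "Suc n"] step \<sigma>dec[of K n] \<sigma>Suc[of n] by simp
      then have "soft_pos (\<sigma> (Suc n)) (g (Suc n) y - H n y) = 0"
        by (rule soft_pos_eq_0) (rule \<sigma>pos)
      then show ?case using step by (simp add: HSuc soft_max_def)
    qed simp
    have "h y = H K y" if y: "y \<in> ball x r" for y
      unfolding h_def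
    proof (rule limI)
      have "\<forall>\<^sub>F n in sequentially. H n y = H K y"
        unfolding eventually_sequentially using const[OF y] by blast
      then show "(\<lambda>n. H n y) \<longlonglongrightarrow> H K y" by (rule tendsto_eventually)
    qed
    moreover have "f y - \<epsilon> \<le> H K y" if "y \<in> ball x r" for y
      using low[OF that] \<sigma>pos[of K] by simp
    ultimately show ?thesis using r const by blast
  qed
  have evH: "\<exists>K. f x - \<epsilon> \<le> H K x \<and> (\<forall>n\<ge>K. H n x = h x) \<and> h x = H K x" if "x \<in> U" for x
    using stable[OF that] by (metis centre_in_ball)
  have "convex_on U h"
  proof (rule convex_onI)
    fix t :: real and x y assume t: "0 < t" "t < 1" and xy: "x \<in> U" "y \<in> U"
    let ?z = "(1 - t) *\<^sub>R x + t *\<^sub>R y"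
    have z: "?z \<in> U" using convexD_alt[OF convex_on_imp_convex[OF conv] xy] t by auto
    obtain i j k where "\<forall>n\<ge>i. H n x = h x" "\<forall>n\<ge>j. H n y = h y" "\<forall>n\<ge>k. H n ?z = h ?z"
      using evH[OF xy(1)] evH[OF xy(2)] evH[OF z] by blast
    then have "H (i + j + k) x = h x" "H (i + j + k) y = h y" "H (i + j + k) ?z = h ?z" by auto
    then show "h ?z \<le> (1 - t) * h x + t * h y"
      using convex_onD[OF Hconv[of "i + j + k"], of t x y] t by simp
  qed (rule convex_on_imp_convex[OF conv])
  moreover have "C1_on U h"
  proof (rule C1_on_locally)
    fix x assume "x \<in> U"
    then obtain r K where "0 < r" "\<forall>y\<in>ball x r. h y = H K y" using stable by blast
    moreover have "C1_on (ball x r) (H K)" by (rule C1_on_subset[OF HC1]) simp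
    ultimately show "\<exists>V k. open V \<and> x \<in> V \<and> C1_on V k \<and> (\<forall>y\<in>V. h y = k y)"
      by (intro exI[of _ "ball x r"] exI[of _ "H K"]) simp
  qed
  moreover have "f x - \<epsilon> \<le> h x \<and> h x \<le> f x" if x: "x \<in> U" for x
  proof -
    obtain K where "f x - \<epsilon> \<le> H K x" "h x = H K x" using evH[OF x] by blast
    then show ?thesis using Hle[OF x, of K] \<sigma>pos[of K] by simp
  qed
  ultimately show ?thesis by blast
qed

section \<open>Ekeland's principle and separability of the dual\<close>

text \<open>
  \<open>S x\<close> consists of the points that improve on \<open>x\<close> by at least \<open>e\<close> times their distance from \<open>x\<close>. Moving
  repeatedly to a point of \<open>S (X n)\<close> that is within \<open>2 ^ -n\<close> of the infimum of \<open>h\<close> over \<open>S (X n)\<close> costs a finite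
  total distance, since \<open>h\<close> is bounded below, and no admissible improvement is left at the limit.
\<close>

theorem ekeland_variational_principle:
  fixes h :: "'a::complete_space \<Rightarrow> real"
  assumes cont: "continuous_on UNIV h" and below: "\<And>x. m \<le> h x" and e: "0 < e"
  obtains x where "\<And>y. h x - e * dist x y \<le> h y"
proof -
  define S where "S x = {y. h y + e * dist x y \<le> h x}" for x
  have self: "x \<in> S x" for x by (simp add: S_def)
  have trans: "S y \<subseteq> S x" if "y \<in> S x" for x y
  proof
    fix z assume "z \<in> S y"
    moreover have "e * dist x z \<le> e * dist x y + e * dist y z"
      using e dist_triangle[of x z y] by (simp flip: distrib_left)
    ultimately show "z \<in> S x" using that by (auto simp: S_def)
  qed
  have bdd: "bdd_below (h ` A)" for A using below by (intro bdd_belowI2) auto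
  have step: "\<exists>y. y \<in> S x \<and> (\<forall>z\<in>S x. h y - (1/2) ^ n < h z)" for x and n :: nat
  proof -
    have "\<exists>y\<in>S x. h y < (INF z\<in>S x. h z) + (1/2) ^ n"
      using cINF_less_iff[OF _ bdd, of "S x" "(INF z\<in>S x. h z) + (1/2) ^ n"] self[of x] by auto
    then obtain y where y: "y \<in> S x" "h y < (INF z\<in>S x. h z) + (1/2) ^ n" by blast
    have "h y - (1/2) ^ n < h z" if "z \<in> S x" for z
      using y(2) cINF_lower[OF bdd that] by linarith
    with y(1) show ?thesis by blast
  qed
  obtain X where X: "\<And>n. X (Suc n) \<in> S (X n)" "\<And>n z. z \<in> S (X n) \<Longrightarrow> h (X (Suc n)) - (1/2) ^ n < h z"
    using dependent_nat_choice[of "\<lambda>_ _. True" "\<lambda>n x y. y \<in> S x \<and> (\<forall>z\<in>S x. h y - (1/2) ^ n < h z)"] step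
    by (metis (no_types, lifting))
  have mono: "X n \<in> S (X k)" if "k \<le> n" for k n
    using that
  proof (induction rule: dec_induct)
    case base show ?case by (rule self)
  next
    case (step n) then show ?case using trans X(1) by blast
  qed
  have "decseq (\<lambda>n. h (X n))"
  proof (rule decseq_SucI)
    fix n
    have "0 \<le> e * dist (X n) (X (Suc n))" using e by simp
    then show "h (X (Suc n)) \<le> h (X n)" using X(1)[of n] unfolding S_def by auto
  qed
  then have "Cauchy (\<lambda>n. h (X n))"
    using decseq_convergent[of "\<lambda>n. h (X n)" m] below by (metis LIMSEQ_imp_Cauchy)
  have "Cauchy X"
  proof (rule metric_CauchyI)
    fix \<eta> :: real assume \<eta>: "0 < \<eta>"
    obtain N where N: "\<And>k. k \<ge> N \<Longrightarrow> dist (h (X k)) (h (X N)) < e * \<eta> / 2"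
      using metric_CauchyD[OF \<open>Cauchy (\<lambda>n. h (X n))\<close>, of "e * \<eta> / 2"] e \<eta> by auto
    have d: "dist (X N) (X k) < \<eta> / 2" if "k \<ge> N" for k
    proof -
      have "e * dist (X N) (X k) < e * (\<eta> / 2)"
      proof -
        have "h (X k) + e * dist (X N) (X k) \<le> h (X N)" using mono[OF that] by (simp add: S_def)
        with N[OF that] have "e * dist (X N) (X k) < e * \<eta> / 2"
          unfolding dist_real_def abs_less_iff by linarith
        then show ?thesis by simp
      qed
      then show ?thesis using e by simp
    qed
    have "dist (X k) (X l) < \<eta>" if "k \<ge> N" "l \<ge> N" for k l
      using d[OF that(1)] d[OF that(2)] dist_triangle3[of "X k" "X l" "X N"] by linarith
    then show "\<exists>N. \<forall>k\<ge>N. \<forall>l\<ge>N. dist (X k) (X l) < \<eta>" by blast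
  qed
  then obtain x where x: "X \<longlonglongrightarrow> x" using Cauchy_convergent convergent_def by blast
  have hx: "(\<lambda>n. h (X n)) \<longlonglongrightarrow> h x"
    by (rule continuous_on_tendsto_compose[OF cont x]) auto
  have xS: "x \<in> S (X k)" for k
  proof -
    have "h x + e * dist (X k) x \<le> h (X k)"
    proof (rule LIMSEQ_le_const2)
      show "(\<lambda>n. h (X n) + e * dist (X k) (X n)) \<longlonglongrightarrow> h x + e * dist (X k) x"
        by (intro tendsto_intros hx x)
      show "\<exists>N. \<forall>n\<ge>N. h (X n) + e * dist (X k) (X n) \<le> h (X k)"
        using mono[of k] by (auto simp: S_def)
    qed
    then show ?thesis by (simp add: S_def)
  qed
  show ?thesis
  proof
    fix y
    show "h x - e * dist x y \<le> h y"
    proof (rule ccontr)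
      assume neg: "\<not> ?thesis"
      then have "y \<in> S x" by (simp add: S_def)
      then have "y \<in> S (X n)" for n using trans[OF xS] by blast
      then have "h (X (Suc n)) - (1/2) ^ n \<le> h y" for n using X(2) less_imp_le by blast
      moreover have "(\<lambda>n. h (X (Suc n)) - (1/2) ^ n) \<longlonglongrightarrow> h x - 0"
        by (intro tendsto_diff LIMSEQ_Suc hx LIMSEQ_power_zero) auto
      ultimately have "h x \<le> h y" using LIMSEQ_le_const2[of _ "h x" "h y"] by auto
      moreover have "0 \<le> e * dist x y" using e by simp
      ultimately show False using neg by simp
    qed
  qed
qed

text \<open>
  At an Ekeland point \<open>h\<close> decreases at rate at most \<open>e\<close> in every direction; applying this to \<open>v\<close> and
  \<open>- v\<close> bounds the derivative on both sides.
\<close>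

lemma ex_small_derivative_of_bounded_below:
  fixes h :: "'a::banach \<Rightarrow> real" and D :: "'a \<Rightarrow> 'a \<Rightarrow>\<^sub>L real"
  assumes der: "\<And>x. (h has_derivative blinfun_apply (D x)) (at x)"
    and below: "\<And>x. m \<le> h x" and e: "0 < e"
  obtains x where "norm (D x) \<le> e"
proof -
  have "continuous_on UNIV h"
    using der by (meson has_derivative_continuous continuous_at_imp_continuous_on)
  then obtain x where x: "\<And>y. h x - e * dist x y \<le> h y"
    using ekeland_variational_principle[of h m e] below e by blast
  have lower: "- (e * norm v) \<le> D x v" for v
  proof -
    have "((\<lambda>t. h (x + t *\<^sub>R v)) has_derivative (\<lambda>t. D x (t *\<^sub>R v))) (at 0)"
      by (rule has_derivative_compose[where f = "\<lambda>t. x + t *\<^sub>R v" and g = h])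
         (auto intro!: derivative_eq_intros der)
    then have "((\<lambda>t. h (x + t *\<^sub>R v)) has_real_derivative D x v) (at 0)"
      by (simp add: has_field_derivative_def blinfun.scaleR_right mult.commute[of _ "D x v"])
    then have "(\<lambda>t. (h (x + t *\<^sub>R v) - h x) / t) \<midarrow>0\<rightarrow> D x v"
      by (simp add: DERIV_def)
    then have "((\<lambda>t. (h (x + t *\<^sub>R v) - h x) / t) \<longlongrightarrow> D x v) (at_right 0)"
      by (simp add: filterlim_at_split)
    then show ?thesis
    proof (rule tendsto_lowerbound)
      show "\<forall>\<^sub>F t in at_right 0. - (e * norm v) \<le> (h (x + t *\<^sub>R v) - h x) / t"
        unfolding eventually_at_right_field
      proof (intro exI[of _ 1] conjI allI impI)
        fix t :: real assume "0 < t" "t < 1"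
        then show "- (e * norm v) \<le> (h (x + t *\<^sub>R v) - h x) / t"
          using x[of "x + t *\<^sub>R v"] by (simp add: dist_norm field_simps)
      qed simp
    qed simp
  qed
  have "norm (D x) \<le> e"
  proof (rule norm_blinfun_bound)
    show "norm (D x v) \<le> e * norm v" for v
      using lower[of v] lower[of "- v"] by (simp add: blinfun.minus_right)
  qed (use e in simp)
  then show ?thesis by (rule that)
qed

text \<open>
  The growth of \<open>g\<close> keeps \<open>g - \<phi>\<close> bounded below for every \<open>\<phi>\<close> in the open unit ball. Scaling by natural
  numbers then carries the density of the derivatives from the unit ball to the whole dual.
\<close>

theorem separable_dual_if_C1_above_norm:
  fixes g :: "'a::banach \<Rightarrow> real"
  assumes sep: "separable_space (euclidean :: 'a topology)"
    and C1: "C1_on UNIV g" and near: "\<And>x. norm x - c \<le> g x"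
  shows "separable_space (euclidean :: ('a \<Rightarrow>\<^sub>L real) topology)"
proof -
  obtain D :: "'a \<Rightarrow> 'a \<Rightarrow>\<^sub>L real" where
    D: "\<And>x. (g has_derivative blinfun_apply (D x)) (at x)" and cont: "continuous_on UNIV D"
    using C1 by (auto simp: C1_on_def)
  obtain S :: "'a set" where S: "countable S" "closure S = UNIV"
    using sep by (auto simp: separable_space_def)
  have dense: "\<exists>s\<in>S. norm (D s - \<phi>) < e" if \<phi>: "norm \<phi> < 1" and e: "0 < e" for \<phi> e
  proof -
    have "((\<lambda>x. g x - \<phi> x) has_derivative blinfun_apply (D x - \<phi>)) (at x)" for x
      unfolding minus_blinfun.rep_eq
      by (intro has_derivative_diff D bounded_linear_imp_has_derivative blinfun.bounded_linear_right)
    moreover have "- c \<le> g x - \<phi> x" for x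
    proof -
      have "\<phi> x \<le> norm \<phi> * norm x" using norm_blinfun[of \<phi> x] by simp
      also have "\<dots> \<le> norm x" using \<phi> by (simp add: mult_left_le_one_le)
      finally show ?thesis using near[of x] by simp
    qed
    ultimately obtain x where x: "norm (D x - \<phi>) \<le> e / 2"
      using ex_small_derivative_of_bounded_below[of "\<lambda>x. g x - \<phi> x" "\<lambda>x. D x - \<phi>" "- c" "e / 2"] e
      by auto
    obtain d where d: "0 < d" "\<And>y. dist y x < d \<Longrightarrow> dist (D y) (D x) < e / 2"
      using cont e unfolding continuous_on_iff by (metis UNIV_I half_gt_zero)
    obtain s where s: "s \<in> S" "dist s x < d"
      using S(2) d(1) closure_approachable[of x S] by auto
    have "norm (D s - \<phi>) < e"
      using norm_triangle_ineq[of "D s - D x" "D x - \<phi>"] d(2)[OF s(2)] x by (simp add: dist_norm)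
    with s(1) show ?thesis by blast
  qed
  define T where "T = (\<Union>n. (\<lambda>s. real (Suc n) *\<^sub>R D s) ` S)"
  have "\<psi> \<in> closure T" for \<psi>
    unfolding closure_approachable
  proof (intro allI impI)
    fix e :: real assume e: "0 < e"
    obtain n where n: "norm \<psi> < real (Suc n)"
      using reals_Archimedean2[of "norm \<psi>"] by (metis less_Suc_eq of_nat_less_iff order_less_trans)
    let ?r = "real (Suc n)"
    have "norm (\<psi> /\<^sub>R ?r) < 1" using n by (simp add: field_simps)
    then obtain s where s: "s \<in> S" "norm (D s - \<psi> /\<^sub>R ?r) < e / ?r"
      using dense[of "\<psi> /\<^sub>R ?r" "e / ?r"] e by auto
    have "?r *\<^sub>R D s - \<psi> = ?r *\<^sub>R (D s - \<psi> /\<^sub>R ?r)" by (simp add: scaleR_diff_right)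
    then have "dist (?r *\<^sub>R D s) \<psi> = ?r * norm (D s - \<psi> /\<^sub>R ?r)"
      by (simp add: dist_norm del: of_nat_Suc)
    also have "\<dots> < ?r * (e / ?r)" using s(2) by (intro mult_strict_left_mono) auto
    finally have "dist (?r *\<^sub>R D s) \<psi> < e" by simp
    then show "\<exists>y\<in>T. dist y \<psi> < e" using s(1) unfolding T_def by blast
  qed
  moreover have "countable T" unfolding T_def using S(1) by auto
  ultimately show ?thesis by (auto simp: separable_space_def)
qed

section \<open>The characterisation\<close>

theorem corollary1p3:
  assumes "separable_space (euclidean :: 'a::banach topology)"
  shows "separable_space (euclidean :: ('a \<Rightarrow>\<^sub>L real) topology) \<longleftrightarrow>
    (\<forall>(U :: 'a set) (f :: 'a \<Rightarrow> real) (\<epsilon> :: real).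
       open U \<and> convex U \<and> continuous_on U f \<and> convex_on U f \<and> \<epsilon> > 0 \<longrightarrow>
       (\<exists>g :: 'a \<Rightarrow> real. convex_on U g \<and> C1_on U g \<and>
          (\<forall>x\<in>U. f x - \<epsilon> \<le> g x \<and> g x \<le> f x)))"
proof (intro iffI allI impI; (elim conjE)?)
  fix U :: "'a set" and f :: "'a \<Rightarrow> real" and \<epsilon> :: real
  assume dual: "separable_space (euclidean :: ('a \<Rightarrow>\<^sub>L real) topology)"
    and "open U" "continuous_on U f" "convex_on U f" "\<epsilon> > 0"
  then show "\<exists>g. convex_on U g \<and> C1_on U g \<and> (\<forall>x\<in>U. f x - \<epsilon> \<le> g x \<and> g x \<le> f x)"
    by (intro ex_C1_convex_approximation_if_lipschitz
        ex_C1_convex_approximation_of_lipschitz[OF assms dual])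
next
  assume approx: "\<forall>(U :: 'a set) (f :: 'a \<Rightarrow> real) (\<epsilon> :: real).
       open U \<and> convex U \<and> continuous_on U f \<and> convex_on U f \<and> \<epsilon> > 0 \<longrightarrow>
       (\<exists>g :: 'a \<Rightarrow> real. convex_on U g \<and> C1_on U g \<and>
          (\<forall>x\<in>U. f x - \<epsilon> \<le> g x \<and> g x \<le> f x))"
  have "convex_on UNIV (norm :: 'a \<Rightarrow> real)"
    using convex_on_dist[of UNIV "0 :: 'a"] by simp
  then obtain g :: "'a \<Rightarrow> real" where "C1_on UNIV g" "\<forall>x. norm x - 1 \<le> g x"
    using approx[rule_format, of UNIV norm 1] by (auto intro: continuous_intros)
  then show "separable_space (euclidean :: ('a \<Rightarrow>\<^sub>L real) topology)"
    using separable_dual_if_C1_above_norm[OF assms] by blast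
qed

end
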